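(* Let $\mathcal{H}$ be a space of the class $\mathfrak{R}$, with Riesz basis of normalized reproducing kernels at the points $T=\{t_n\}$ and associated weights $b=\{b_n\}$. Assume that $T\subset\mathbb{R}$ and that the polynomials (restricted to $T$) belong to $\ell^2(T,b)$ and are dense in $\ell^2(T,b)$. Then, for every exact system of reproducing kernels in $\mathcal{H}$, the closed linear span of its biorthogonal system has finite codimension in $\mathcal{H}$.
   Context: A system of vectors $\{v_n\}$ in a Hilbert space $\mathcal{H}$ is complete if its closed linear span is $\mathcal{H}$; it is exact if it is complete and fails to be complete when any one vector is removed. An exact system $\{v_n\}$ has a unique biorthogonal system $\{w_m\}\subset\mathcal{H}$, i.e. $\langle v_n,w_m\rangle=\delta_{nm}$. A Riesz basis is the image of an orthonormal basis under a bounded invertible operator. The class $\mathfrak{R}$ consists of the (separable) Hilbert spaces $\mathcal{H}$ of entire functions such that: (A1) for every $\lambda\in\mathbb{C}$ there is $k_\lambda\in\mathcal{H}$ (the reproducing kernel) with $\langle f,k_\lambda\rangle=f(\lambda)$ for all $f\in\mathcal{H}$; (A2) if $f\in\mathcal{H}$ and $f(w)=0$, then $\frac{f(z)}{z-w}\in\mathcal{H}$; (A3) there is a sequence of distinct points $T=\{t_n\}\subset\mathbb{C}$ such that $\{k_{t_n}/\|k_{t_n}\|_{\mathcal{H}}\}$ is a Riesz basis of $\mathcal{H}$. The sequence $T$ is infinite and is fixed. The generating function $F$ of $T$ is the entire function, unique up to a nonzero multiplicative constant, such that the system biorthogonal to $\{k_{t_n}/\|k_{t_n}\|_{\mathcal{H}}\}$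 is $\left\{\frac{\|k_{t_n}\|_{\mathcal{H}}}{F'(t_n)}\cdot\frac{F(z)}{z-t_n}\right\}$. The weights are $b_n:=\|k_{t_n}\|_{\mathcal{H}}^2/|F'(t_n)|^2$; they satisfy $\sum_n b_n/(1+|t_n|^2)<+\infty$. Equivalently, $\mathcal{H}$ corresponds to the space $\mathcal{H}(T,b)$ of all functions $f(z)=\sum_n\frac{a_nb_n^{1/2}}{z-t_n}$ with $\{a_n\}\in\ell^2$ and norm $\|\{a_n\}\|_{\ell^2}$, via the isomorphism $f\mapsto Ff$ of $\mathcal{H}(T,b)$ onto $\mathcal{H}$. $\ell^2(T,b):=\{f:T\to\mathbb{C}:\ \sum_n|f(t_n)|^2b_n<+\infty\}$, with its natural Hilbert space norm. *)

theory Defs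
  imports
    "HOL-Complex_Analysis.Complex_Analysis"
    "HOL-Computational_Algebra.Polynomial"
    "HOL-Library.Function_Algebras"
begin

text \<open>
  Complex-valued functions on the plane form a complex vector space; this provides
  \<open>cfun.subspace\<close> and \<open>cfun.span\<close> (finite complex linear combinations).
  Addition and subtraction of functions are pointwise, from \<open>Function_Algebras\<close>.
\<close>

definition cscale :: "complex \<Rightarrow> (complex \<Rightarrow> complex) \<Rightarrow> complex \<Rightarrow> complex" where
  "cscale c f = (\<lambda>z. c * f z)"

interpretation cfun: vector_space cscale
  by standard (simp_all add: cscale_def fun_eq_iff algebra_simps)

text \<open>
  A Hilbert space of functions is a carrier \<open>H\<close> together with an inner product \<open>ip\<close>, linear in
  its first argument; only the values of \<open>ip\<close> on \<open>H \<times> H\<close> are meaningful.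
\<close>

definition hnorm ::
  "((complex \<Rightarrow> complex) \<Rightarrow> (complex \<Rightarrow> complex) \<Rightarrow> complex) \<Rightarrow> (complex \<Rightarrow> complex) \<Rightarrow> real"
  where "hnorm ip f = sqrt (Re (ip f f))"

text \<open>
  The locale \<open>Metric_space\<close> demands symmetry and nonnegativity of the distance on the whole type,
  hence the guard outside the carrier.
\<close>

definition hdist ::
  "(complex \<Rightarrow> complex) set \<Rightarrow> ((complex \<Rightarrow> complex) \<Rightarrow> (complex \<Rightarrow> complex) \<Rightarrow> complex) \<Rightarrow>
   (complex \<Rightarrow> complex) \<Rightarrow> (complex \<Rightarrow> complex) \<Rightarrow> real"
  where "hdist H ip f g = (if f \<in> H \<and> g \<in> H then hnorm ip (f - g) else 0)"

definition hclosure ::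
  "(complex \<Rightarrow> complex) set \<Rightarrow> ((complex \<Rightarrow> complex) \<Rightarrow> (complex \<Rightarrow> complex) \<Rightarrow> complex) \<Rightarrow>
   (complex \<Rightarrow> complex) set \<Rightarrow> (complex \<Rightarrow> complex) set"
  where "hclosure H ip S = (Metric_space.mtopology H (hdist H ip)) closure_of S"

locale entire_hilbert_space =
  fixes H :: "(complex \<Rightarrow> complex) set"
    and ip :: "(complex \<Rightarrow> complex) \<Rightarrow> (complex \<Rightarrow> complex) \<Rightarrow> complex"
  assumes subspace: "cfun.subspace H"
    and ip_add_left: "\<lbrakk>f \<in> H; g \<in> H; h \<in> H\<rbrakk> \<Longrightarrow> ip (f + g) h = ip f h + ip g h"
    and ip_scale_left: "\<lbrakk>f \<in> H; h \<in> H\<rbrakk> \<Longrightarrow> ip (cscale c f) h = c * ip f h"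
    and ip_commute: "\<lbrakk>f \<in> H; g \<in> H\<rbrakk> \<Longrightarrow> ip g f = cnj (ip f g)"
    and ip_nonneg: "f \<in> H \<Longrightarrow> 0 \<le> Re (ip f f)"
    and ip_definite: "\<lbrakk>f \<in> H; ip f f = 0\<rbrakk> \<Longrightarrow> f = 0"
    and complete: "Metric_space.mcomplete H (hdist H ip)"
    and separable: "\<exists>D. countable D \<and> D \<subseteq> H \<and> hclosure H ip D = H"
    and entire: "f \<in> H \<Longrightarrow> f holomorphic_on UNIV"

definition closed_span ::
  "(complex \<Rightarrow> complex) set \<Rightarrow> ((complex \<Rightarrow> complex) \<Rightarrow> (complex \<Rightarrow> complex) \<Rightarrow> complex) \<Rightarrow>
   (complex \<Rightarrow> complex) set \<Rightarrow> (complex \<Rightarrow> complex) set"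
  where "closed_span H ip S = hclosure H ip (cfun.span S)"

text \<open>A system is a family \<open>v\<close> indexed by the elements of a set \<open>I\<close>.\<close>

definition complete_system ::
  "(complex \<Rightarrow> complex) set \<Rightarrow> ((complex \<Rightarrow> complex) \<Rightarrow> (complex \<Rightarrow> complex) \<Rightarrow> complex) \<Rightarrow>
   'i set \<Rightarrow> ('i \<Rightarrow> complex \<Rightarrow> complex) \<Rightarrow> bool"
  where "complete_system H ip I v \<longleftrightarrow> v ` I \<subseteq> H \<and> closed_span H ip (v ` I) = H"

definition exact_system ::
  "(complex \<Rightarrow> complex) set \<Rightarrow> ((complex \<Rightarrow> complex) \<Rightarrow> (complex \<Rightarrow> complex) \<Rightarrow> complex) \<Rightarrow>
   'i set \<Rightarrow> ('i \<Rightarrow> complex \<Rightarrow> complex) \<Rightarrow> bool"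
  where "exact_system H ip I v \<longleftrightarrow>
    complete_system H ip I v \<and> (\<forall>i\<in>I. \<not> complete_system H ip (I - {i}) v)"

definition biorthogonal_system ::
  "(complex \<Rightarrow> complex) set \<Rightarrow> ((complex \<Rightarrow> complex) \<Rightarrow> (complex \<Rightarrow> complex) \<Rightarrow> complex) \<Rightarrow>
   'i set \<Rightarrow> ('i \<Rightarrow> complex \<Rightarrow> complex) \<Rightarrow> ('i \<Rightarrow> complex \<Rightarrow> complex) \<Rightarrow> bool"
  where "biorthogonal_system H ip I v w \<longleftrightarrow>
    w ` I \<subseteq> H \<and> (\<forall>n\<in>I. \<forall>m\<in>I. ip (v n) (w m) = (if n = m then 1 else 0))"

definition orthonormal_basis ::
  "(complex \<Rightarrow> complex) set \<Rightarrow> ((complex \<Rightarrow> complex) \<Rightarrow> (complex \<Rightarrow> complex) \<Rightarrow> complex) \<Rightarrow>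
   'i set \<Rightarrow> ('i \<Rightarrow> complex \<Rightarrow> complex) \<Rightarrow> bool"
  where "orthonormal_basis H ip I e \<longleftrightarrow>
    complete_system H ip I e \<and>
    (\<forall>n\<in>I. \<forall>m\<in>I. ip (e n) (e m) = (if n = m then 1 else 0))"

definition bounded_invertible_operator ::
  "(complex \<Rightarrow> complex) set \<Rightarrow> ((complex \<Rightarrow> complex) \<Rightarrow> (complex \<Rightarrow> complex) \<Rightarrow> complex) \<Rightarrow>
   ((complex \<Rightarrow> complex) \<Rightarrow> complex \<Rightarrow> complex) \<Rightarrow> bool"
  where "bounded_invertible_operator H ip A \<longleftrightarrow>
    bij_betw A H H \<and>
    (\<forall>f\<in>H. \<forall>g\<in>H. A (f + g) = A f + A g) \<and>
    (\<forall>c. \<forall>f\<in>H. A (cscale c f) = cscale c (A f)) \<and>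
    (\<exists>C. \<forall>f\<in>H. hnorm ip (A f) \<le> C * hnorm ip f) \<and>
    (\<exists>C. \<forall>g\<in>H. hnorm ip (inv_into H A g) \<le> C * hnorm ip g)"

definition riesz_basis ::
  "(complex \<Rightarrow> complex) set \<Rightarrow> ((complex \<Rightarrow> complex) \<Rightarrow> (complex \<Rightarrow> complex) \<Rightarrow> complex) \<Rightarrow>
   'i set \<Rightarrow> ('i \<Rightarrow> complex \<Rightarrow> complex) \<Rightarrow> bool"
  where "riesz_basis H ip I v \<longleftrightarrow>
    (\<exists>e A. orthonormal_basis H ip I e \<and> bounded_invertible_operator H ip A \<and>
           (\<forall>i\<in>I. v i = A (e i)))"

definition is_reproducing_kernel ::
  "(complex \<Rightarrow> complex) set \<Rightarrow> ((complex \<Rightarrow> complex) \<Rightarrow> (complex \<Rightarrow> complex) \<Rightarrow> complex) \<Rightarrow>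
   complex \<Rightarrow> (complex \<Rightarrow> complex) \<Rightarrow> bool"
  where "is_reproducing_kernel H ip w k \<longleftrightarrow> k \<in> H \<and> (\<forall>f\<in>H. ip f k = f w)"

definition rkernel ::
  "(complex \<Rightarrow> complex) set \<Rightarrow> ((complex \<Rightarrow> complex) \<Rightarrow> (complex \<Rightarrow> complex) \<Rightarrow> complex) \<Rightarrow>
   complex \<Rightarrow> complex \<Rightarrow> complex"
  where "rkernel H ip w = (THE k. is_reproducing_kernel H ip w k)"

definition normalized_rkernel ::
  "(complex \<Rightarrow> complex) set \<Rightarrow> ((complex \<Rightarrow> complex) \<Rightarrow> (complex \<Rightarrow> complex) \<Rightarrow> complex) \<Rightarrow>
   complex \<Rightarrow> complex \<Rightarrow> complex"
  where "normalized_rkernel H ip w =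
    cscale (complex_of_real (1 / hnorm ip (rkernel H ip w))) (rkernel H ip w)"

text \<open>
  For \<open>f\<close> entire with \<open>f w = 0\<close>, this is the entire function \<open>f z / (z - w)\<close>, with
  its removable singularity at \<open>w\<close> filled in.
\<close>

definition zero_quotient :: "(complex \<Rightarrow> complex) \<Rightarrow> complex \<Rightarrow> complex \<Rightarrow> complex" where
  "zero_quotient f w = (\<lambda>z. if z = w then deriv f w else f z / (z - w))"

locale class_R = entire_hilbert_space H ip
  for H :: "(complex \<Rightarrow> complex) set"
    and ip :: "(complex \<Rightarrow> complex) \<Rightarrow> (complex \<Rightarrow> complex) \<Rightarrow> complex" +
  fixes t :: "nat \<Rightarrow> complex"
  assumes A1: "\<exists>k. is_reproducing_kernel H ip w k"
    and A2: "\<lbrakk>f \<in> H; f w = 0\<rbrakk> \<Longrightarrow> zero_quotient f w \<in> H"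
    and distinct: "inj t"
    and A3: "riesz_basis H ip UNIV (\<lambda>n. normalized_rkernel H ip (t n))"

definition generating_function ::
  "(complex \<Rightarrow> complex) set \<Rightarrow> ((complex \<Rightarrow> complex) \<Rightarrow> (complex \<Rightarrow> complex) \<Rightarrow> complex) \<Rightarrow>
   (nat \<Rightarrow> complex) \<Rightarrow> (complex \<Rightarrow> complex) \<Rightarrow> bool"
  where "generating_function H ip t F \<longleftrightarrow>
    F holomorphic_on UNIV \<and>
    (\<forall>n. F (t n) = 0 \<and> deriv F (t n) \<noteq> 0) \<and>
    biorthogonal_system H ip UNIV
      (\<lambda>n. normalized_rkernel H ip (t n))
      (\<lambda>n. cscale (complex_of_real (hnorm ip (rkernel H ip (t n))) / deriv F (t n))
                  (zero_quotient F (t n)))"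

definition weight ::
  "((complex \<Rightarrow> complex) set) \<Rightarrow> ((complex \<Rightarrow> complex) \<Rightarrow> (complex \<Rightarrow> complex) \<Rightarrow> complex) \<Rightarrow>
   (nat \<Rightarrow> complex) \<Rightarrow> (complex \<Rightarrow> complex) \<Rightarrow> nat \<Rightarrow> real"
  where "weight H ip t F n =
    (hnorm ip (rkernel H ip (t n)))\<^sup>2 / (cmod (deriv F (t n)))\<^sup>2"

text \<open>
  Functions on \<open>T = range t\<close> are represented by functions in \<open>extensional (range t)\<close>.  As \<open>t\<close> will be
  injective, summing over indices is summing over \<open>T\<close>.
\<close>

definition weighted_l2 :: "(nat \<Rightarrow> complex) \<Rightarrow> (nat \<Rightarrow> real) \<Rightarrow> (complex \<Rightarrow> complex) set" where
  "weighted_l2 t b =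
    {f \<in> extensional (range t). summable (\<lambda>n. (cmod (f (t n)))\<^sup>2 * b n)}"

definition weighted_l2_norm :: "(nat \<Rightarrow> complex) \<Rightarrow> (nat \<Rightarrow> real) \<Rightarrow> (complex \<Rightarrow> complex) \<Rightarrow> real"
  where "weighted_l2_norm t b f = sqrt (\<Sum>n. (cmod (f (t n)))\<^sup>2 * b n)"

definition polynomials_on :: "complex set \<Rightarrow> (complex \<Rightarrow> complex) set" where
  "polynomials_on T = range (\<lambda>p :: complex poly. restrict (poly p) T)"

definition polynomials_dense :: "(nat \<Rightarrow> complex) \<Rightarrow> (nat \<Rightarrow> real) \<Rightarrow> bool" where
  "polynomials_dense t b \<longleftrightarrow>
    (\<forall>f\<in>weighted_l2 t b. \<forall>\<epsilon>>0. \<exists>g\<in>polynomials_on (range t).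
       weighted_l2_norm t b (\<lambda>z. f z - g z) < \<epsilon>)"

text \<open>\<open>M\<close> has finite codimension in \<open>H\<close>: the quotient of \<open>H\<close> by \<open>M\<close> is spanned by finitely many classes.\<close>

definition finite_codimension ::
  "(complex \<Rightarrow> complex) set \<Rightarrow> (complex \<Rightarrow> complex) set \<Rightarrow> bool"
  where "finite_codimension H M \<longleftrightarrow>
    (\<exists>B. finite B \<and> B \<subseteq> H \<and> (\<forall>f\<in>H. \<exists>m\<in>M. \<exists>c\<in>cfun.span B. f = m + c))"

end

theory Submission
  imports Defs
begin

text \<open>
  Let \<open>W\<close> be one element of the biorthogonal system. Its zeros are simple, and dividing one of them
  out yields combinations of biorthogonal elements. If \<open>h\<close> is orthogonal to the biorthogonal system,
  with conjugated Riesz coefficients \<open>c\<^sub>n\<close>, then the entire function \<open>\<Phi> = F \<cdot> \<Sum>\<^sub>n \<sigma>\<^sub>n / (z - t\<^sub>n)\<close>,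
  \<open>\<sigma>\<^sub>n = W(t\<^sub>n) c\<^sub>n / \<parallel>k\<^sub>n\<parallel>\<close>, therefore vanishes at the zeros of \<open>W\<close>, so that \<open>S = \<Phi> / W\<close> is entire.
  Off the real line \<open>S = (\<Phi> / F) / g\<close> is a quotient of Cauchy transforms of absolutely summable
  sequences, where \<open>g = W / F\<close> does not depend on \<open>h\<close>. Density of the polynomials
  forces some moment of the sequence defining \<open>g\<close> to be nonzero, so \<open>g\<close> decays only like a
  power of \<open>z\<close> away from the real line. Dividing out Blaschke factors on discs and using Harnack's inequality bounds \<open>\<bar>S\<bar>\<close> by
  \<open>exp (L / (Im z)\<^sup>2)\<close> with \<open>L = O(ln \<bar>z\<bar>)\<close>, and the maximum principle on rhombi removes the
  singularity at the real line. Hence \<open>S\<close> is a polynomial whose degree is bounded independently of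
  \<open>h\<close>, and finitely many coefficients \<open>c\<^sub>n\<close> determine \<open>h\<close>.
\<close>

section \<open>Hilbert space geometry\<close>

text \<open>By the Riesz expansion, orthogonality of h to W / (z - z0) says that the sum of
  \<open>\<sigma> n / (t n - z0)\<close> is zero; off the nodes this is the vanishing of \<Phi> at
  z0. The obstacle is the growth of S. Both Cauchy transforms are bounded only by a multiple of 1 /
  |Im z|, and nothing keeps the zeros of g away from the real line, so S cannot be estimated there
  by division. A disc centred at height 1 and reaching towards the line still gives an estimate, but
  its Harnack exponent costs a factor of order 1 / |Im z| in ln |S|, and the boundary bound adds a
  logarithm of 1 / |Im z|; the square in the singular bound absorbs both. Since S is entire, the
  estimates from above and below the line can be joined across it. The constant 72 in the degree
  bound is 18 * 4: the disc gives the exponent 4 / |Im z|, the barrier on the rhombus gives 18. The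
  degree bound depends only on the index of the first nonzero moment, which belongs to W; this
  uniformity in h is what makes the orthogonal complement finite-dimensional.\<close>

context entire_hilbert_space
begin

lemma hs_add: "f \<in> H \<Longrightarrow> g \<in> H \<Longrightarrow> f + g \<in> H"
  using subspace by (simp add: cfun.subspace_def)

lemma hs_scale: "f \<in> H \<Longrightarrow> cscale c f \<in> H"
  using subspace by (simp add: cfun.subspace_def)

lemma hs_zero: "0 \<in> H"
  using subspace by (simp add: cfun.subspace_def)

lemma hs_diff: "f \<in> H \<Longrightarrow> g \<in> H \<Longrightarrow> f - g \<in> H"
  using subspace by (simp add: cfun.subspace_diff)

lemma hs_sum: "(\<And>i. i \<in> I \<Longrightarrow> f i \<in> H) \<Longrightarrow> sum f I \<in> H"
  using subspace by (simp add: cfun.subspace_sum)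

lemmas hs_closed = hs_add hs_scale hs_zero hs_diff hs_sum

lemma hs_span: "S \<subseteq> H \<Longrightarrow> cfun.span S \<subseteq> H"
  by (simp add: cfun.span_minimal subspace)

lemma ip_zero_left: "h \<in> H \<Longrightarrow> ip 0 h = 0"
  using ip_scale_left[of 0 h 0] hs_zero by (simp add: cscale_def zero_fun_def)

lemma ip_diff_left: "\<lbrakk>f \<in> H; g \<in> H; h \<in> H\<rbrakk> \<Longrightarrow> ip (f - g) h = ip f h - ip g h"
  using ip_add_left[of "f - g" g h] hs_diff by (simp add: algebra_simps)

lemma ip_sum_left:
  "\<lbrakk>\<And>i. i \<in> I \<Longrightarrow> f i \<in> H; h \<in> H\<rbrakk> \<Longrightarrow> ip (sum f I) h = (\<Sum>i\<in>I. ip (f i) h)"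
proof (induction I rule: infinite_finite_induct)
  case (insert x I)
  have "f x \<in> H" "sum f I \<in> H" using insert.prems hs_sum[of I f] by auto
  then have "ip (f x + sum f I) h = ip (f x) h + ip (sum f I) h"
    using insert.prems ip_add_left by blast
  then show ?case using insert by (metis insertI2 sum.insert)
qed (simp_all add: ip_zero_left)

lemma ip_zero_right: "h \<in> H \<Longrightarrow> ip h 0 = 0"
  using ip_commute[of 0 h] ip_zero_left[of h] hs_zero by simp

lemma ip_add_right: "\<lbrakk>f \<in> H; g \<in> H; h \<in> H\<rbrakk> \<Longrightarrow> ip h (f + g) = ip h f + ip h g"
  by (metis complex_cnj_add hs_add ip_add_left ip_commute)

lemma ip_diff_right: "\<lbrakk>f \<in> H; g \<in> H; h \<in> H\<rbrakk> \<Longrightarrow> ip h (f - g) = ip h f - ip h g"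
  by (metis complex_cnj_diff hs_diff ip_diff_left ip_commute)

lemma ip_scale_right: "\<lbrakk>f \<in> H; h \<in> H\<rbrakk> \<Longrightarrow> ip h (cscale c f) = cnj c * ip h f"
  by (metis complex_cnj_mult hs_scale ip_scale_left ip_commute)

lemma ip_sum_right:
  "\<lbrakk>\<And>i. i \<in> I \<Longrightarrow> f i \<in> H; h \<in> H\<rbrakk> \<Longrightarrow> ip h (sum f I) = (\<Sum>i\<in>I. ip h (f i))"
proof (induction I rule: infinite_finite_induct)
  case (insert x I)
  have "f x \<in> H" "sum f I \<in> H" using insert.prems hs_sum[of I f] by auto
  then have "ip h (f x + sum f I) = ip h (f x) + ip h (sum f I)"
    using insert.prems ip_add_right by blast
  then show ?case using insert by (metis insertI2 sum.insert)
qed (simp_all add: ip_zero_right)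

lemma ip_self: "f \<in> H \<Longrightarrow> ip f f = complex_of_real ((hnorm ip f)\<^sup>2)"
proof -
  assume f: "f \<in> H"
  have "Im (ip f f) = 0" using ip_commute[OF f f] by (metis Im_complex_of_real complex_cnj_cancel_iff Reals_cnj_iff complex_is_Real_iff)
  then show ?thesis using ip_nonneg[OF f] by (simp add: hnorm_def complex_eq_iff)
qed

lemma hnorm_ge0: "f \<in> H \<Longrightarrow> 0 \<le> hnorm ip f"
  by (simp add: hnorm_def ip_nonneg)

lemma hnorm_zero: "hnorm ip 0 = 0"
  unfolding hnorm_def using ip_zero_left[OF hs_zero] by simp

lemma hnorm_eq0: "f \<in> H \<Longrightarrow> hnorm ip f = 0 \<longleftrightarrow> f = 0"
  by (metis hnorm_zero ip_definite ip_self of_real_0 power_zero_numeral)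

lemma hnorm_scale: "f \<in> H \<Longrightarrow> hnorm ip (cscale c f) = cmod c * hnorm ip f"
proof -
  assume f: "f \<in> H"
  have "ip (cscale c f) (cscale c f) = c * cnj c * ip f f"
    using f by (simp add: ip_scale_left ip_scale_right hs_scale)
  also have "\<dots> = complex_of_real ((cmod c)\<^sup>2 * (hnorm ip f)\<^sup>2)"
    using f by (simp add: ip_self complex_norm_square[symmetric])
  finally have "Re (ip (cscale c f) (cscale c f)) = (cmod c * hnorm ip f)\<^sup>2"
    by (simp add: power_mult_distrib)
  then show ?thesis
    using hnorm_ge0[OF f] by (simp add: hnorm_def[of ip "cscale c f"])
qed

lemma hnorm_uminus: "f \<in> H \<Longrightarrow> hnorm ip (- f) = hnorm ip f"
  using hnorm_scale[of f "-1"] by (simp add: cscale_def fun_Compl_def)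

lemma hnorm_minus_commute: "f \<in> H \<Longrightarrow> g \<in> H \<Longrightarrow> hnorm ip (f - g) = hnorm ip (g - f)"
  using hnorm_uminus[of "f - g"] hs_diff by simp

lemma hnorm_add_sq:
  assumes "f \<in> H" "g \<in> H"
  shows "(hnorm ip (f + g))\<^sup>2 = (hnorm ip f)\<^sup>2 + 2 * Re (ip f g) + (hnorm ip g)\<^sup>2"
proof -
  have "ip (f + g) (f + g) = ip f f + ip g g + (ip f g + ip g f)"
    using assms by (simp add: ip_add_left ip_add_right hs_add)
  moreover have "Re (ip f g + ip g f) = 2 * Re (ip f g)"
    using ip_commute[OF assms] by simp
  moreover have "Re (ip (f + g) (f + g)) = (hnorm ip (f + g))\<^sup>2"
    using ip_self[of "f + g"] assms hs_add by simp
  moreover have "Re (ip f f) = (hnorm ip f)\<^sup>2" "Re (ip g g) = (hnorm ip g)\<^sup>2"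
    using ip_self assms by simp_all
  ultimately show ?thesis by simp
qed

lemma hnorm_diff_sq:
  assumes "f \<in> H" "g \<in> H"
  shows "(hnorm ip (f - g))\<^sup>2 = (hnorm ip f)\<^sup>2 - 2 * Re (ip f g) + (hnorm ip g)\<^sup>2"
proof -
  have eq: "f - g = f + cscale (-1) g" by (simp add: cscale_def fun_eq_iff)
  have "ip f (cscale (-1) g) = - ip f g" using ip_scale_right[of g f "-1"] assms by simp
  then show ?thesis
    unfolding eq using hnorm_add_sq[of f "cscale (-1) g"] assms hs_scale[of g "-1"] hnorm_scale[of g "-1"]
    by simp
qed

lemma cauchy_schwarz:
  assumes f: "f \<in> H" and g: "g \<in> H"
  shows "cmod (ip f g) \<le> hnorm ip f * hnorm ip g"
proof (cases "g = 0")
  case True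
  then show ?thesis using f by (simp add: ip_zero_right hnorm_zero)
next
  case False
  define n where "n = (hnorm ip g)\<^sup>2"
  have n: "n > 0" using False g hnorm_eq0 by (simp add: n_def)
  \<comment> \<open>\<open>cscale a g\<close> is the multiple of \<open>g\<close> nearest to
    \<open>f\<close>.\<close>
  define a where "a = ip f g / of_real n"
  have "0 \<le> (hnorm ip (f - cscale a g))\<^sup>2" by simp
  also have "\<dots> = (hnorm ip f)\<^sup>2 - 2 * Re (cnj a * ip f g) + (cmod a)\<^sup>2 * n"
    using f g by (simp add: hnorm_diff_sq hs_scale hnorm_scale ip_scale_right n_def power_mult_distrib)
  also have "cnj a * ip f g = complex_of_real ((cmod (ip f g))\<^sup>2 / n)"
    using complex_norm_square[of "ip f g"] by (simp add: a_def mult.commute)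
  also have "(cmod a)\<^sup>2 * n = (cmod (ip f g))\<^sup>2 / n"
    using n by (simp add: a_def norm_divide power2_eq_square)
  finally have "(cmod (ip f g))\<^sup>2 / n \<le> (hnorm ip f)\<^sup>2" by simp
  then have "(cmod (ip f g))\<^sup>2 \<le> (hnorm ip f * hnorm ip g)\<^sup>2"
    using n by (simp add: field_simps n_def power_mult_distrib)
  then show ?thesis
    by (rule power2_le_imp_le) (simp add: f g hnorm_ge0)
qed

lemma hnorm_triangle:
  assumes "f \<in> H" "g \<in> H"
  shows "hnorm ip (f + g) \<le> hnorm ip f + hnorm ip g"
proof (rule power2_le_imp_le)
  have "Re (ip f g) \<le> hnorm ip f * hnorm ip g"
    using cauchy_schwarz[OF assms] complex_Re_le_cmod order_trans by blast
  then show "(hnorm ip (f + g))\<^sup>2 \<le> (hnorm ip f + hnorm ip g)\<^sup>2"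
    using hnorm_add_sq[OF assms] by (simp add: power2_eq_square algebra_simps)
  show "0 \<le> hnorm ip f + hnorm ip g" using assms by (simp add: hnorm_ge0)
qed

lemma hnorm_triangle_diff:
  assumes "f \<in> H" "g \<in> H" "h \<in> H"
  shows "hnorm ip (f - h) \<le> hnorm ip (f - g) + hnorm ip (g - h)"
  using hnorm_triangle[of "f - g" "g - h"] assms by (simp add: hs_diff)

lemma metric: "Metric_space H (hdist H ip)"
proof
  fix f g h
  show "0 \<le> hdist H ip f g" by (simp add: hdist_def hnorm_ge0 hs_diff)
  show "hdist H ip f g = hdist H ip g f"
    using hnorm_minus_commute by (auto simp: hdist_def)
  show "hdist H ip f g = 0 \<longleftrightarrow> f = g" if "f \<in> H" "g \<in> H"
    using that hnorm_eq0[of "f - g"] by (simp add: hdist_def hs_diff)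
  show "hdist H ip f h \<le> hdist H ip f g + hdist H ip g h" if "f \<in> H" "g \<in> H" "h \<in> H"
    using that hnorm_triangle_diff by (simp add: hdist_def)
qed

lemma in_hclosure_iff:
  assumes "S \<subseteq> H"
  shows "x \<in> hclosure H ip S \<longleftrightarrow> x \<in> H \<and> (\<forall>\<epsilon>>0. \<exists>y\<in>S. hnorm ip (x - y) < \<epsilon>)"
proof -
  interpret Metric_space H "hdist H ip" by (rule metric)
  show ?thesis
    using assms unfolding hclosure_def metric_closure_of
    by (simp add: mball_def hdist_def subset_eq) metis
qed

lemma hclosure_subset: "S \<subseteq> H \<Longrightarrow> hclosure H ip S \<subseteq> H"
  using in_hclosure_iff by blast

lemma subset_hclosure: "S \<subseteq> H \<Longrightarrow> S \<subseteq> hclosure H ip S"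
  by (metis (no_types) in_hclosure_iff hnorm_zero subset_eq diff_self)

lemma hnorm_Cauchy_converges:
  assumes x: "\<And>n. x n \<in> H"
    and cauchy: "\<And>\<epsilon>. \<epsilon> > 0 \<Longrightarrow> \<exists>N. \<forall>m\<ge>N. \<forall>n\<ge>N. hnorm ip (x m - x n) < \<epsilon>"
  shows "\<exists>y\<in>H. (\<lambda>n. hnorm ip (x n - y)) \<longlonglongrightarrow> 0"
proof -
  interpret Metric_space H "hdist H ip" by (rule metric)
  have "MCauchy x"
    using x cauchy by (simp add: MCauchy_def hdist_def image_subset_iff)
  then obtain y where y: "limitin mtopology x y sequentially"
    using complete by (auto simp: mcomplete_def)
  then have "y \<in> H" and "(\<lambda>n. hdist H ip (x n) y) \<longlonglongrightarrow> 0"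
    using limitin_metric_dist_null by blast+
  then show ?thesis using x by (auto simp: hdist_def)
qed

section \<open>Closed spans, orthogonality and projection\<close>

lemma closed_span_orthogonal:
  assumes "S \<subseteq> H" "h \<in> H" "\<And>s. s \<in> S \<Longrightarrow> ip s h = 0" "x \<in> closed_span H ip S"
  shows "ip x h = 0"
proof -
  have sub: "cfun.subspace {s \<in> H. ip s h = 0}"
    using assms(2) by (auto simp: cfun.subspace_def hs_closed ip_add_left ip_scale_left ip_zero_left)
  have span: "cfun.span S \<subseteq> {s \<in> H. ip s h = 0}"
    using assms by (intro cfun.span_minimal sub) auto
  have x: "x \<in> H" "\<And>\<epsilon>. \<epsilon> > 0 \<Longrightarrow> \<exists>y\<in>cfun.span S. hnorm ip (x - y) < \<epsilon>"
    using assms(4) in_hclosure_iff[OF hs_span[OF assms(1)]] by (auto simp: closed_span_def)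
  have bound: "cmod (ip x h) \<le> \<epsilon>" if "\<epsilon> > 0" for \<epsilon>
  proof -
    have "\<epsilon> / (1 + hnorm ip h) > 0"
      using that hnorm_ge0[OF assms(2)] by (simp add: add_pos_nonneg)
    then obtain y where y: "y \<in> cfun.span S" "hnorm ip (x - y) < \<epsilon> / (1 + hnorm ip h)"
      using x(2) by blast
    have yH: "y \<in> H" "ip y h = 0" using span y(1) by auto
    have "cmod (ip x h) = cmod (ip (x - y) h)"
      using x(1) yH assms(2) by (simp add: ip_diff_left)
    also have "\<dots> \<le> hnorm ip (x - y) * hnorm ip h"
      using x(1) yH assms(2) by (simp add: cauchy_schwarz hs_diff)
    also have "\<dots> \<le> \<epsilon> / (1 + hnorm ip h) * (1 + hnorm ip h)"
    proof (rule mult_mono)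
      show "hnorm ip (x - y) \<le> \<epsilon> / (1 + hnorm ip h)" using y(2) by simp
      show "0 \<le> hnorm ip h" by (rule hnorm_ge0[OF assms(2)])
      show "0 \<le> \<epsilon> / (1 + hnorm ip h)" using \<open>\<epsilon> / (1 + hnorm ip h) > 0\<close> by simp
    qed simp
    also have "\<dots> = \<epsilon>" using hnorm_ge0[OF assms(2)] by simp
    finally show ?thesis .
  qed
  then have "cmod (ip x h) \<le> 0" using field_le_epsilon[of "cmod (ip x h)" 0] by simp
  then show ?thesis by simp
qed

lemma complete_system_orthogonal_eq_0:
  assumes "complete_system H ip I v" "h \<in> H" "\<And>i. i \<in> I \<Longrightarrow> ip (v i) h = 0"
  shows "h = 0"
proof -
  have "ip h h = 0"
    using closed_span_orthogonal[of "v ` I" h h] assms unfolding complete_system_def by blast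
  then show ?thesis using assms(2) ip_definite by blast
qed

lemma closed_span_closed:
  assumes "S \<subseteq> H" "\<And>n::nat. x n \<in> closed_span H ip S" "y \<in> H" "(\<lambda>n. hnorm ip (x n - y)) \<longlonglongrightarrow> 0"
  shows "y \<in> closed_span H ip S"
  unfolding closed_span_def in_hclosure_iff[OF hs_span[OF assms(1)]]
proof (intro conjI allI impI)
  show "y \<in> H" by fact
  fix \<epsilon> :: real assume "\<epsilon> > 0"
  then have "eventually (\<lambda>n. hnorm ip (x n - y) < \<epsilon> / 2) sequentially"
    using order_tendstoD(2)[OF assms(4), of "\<epsilon> / 2"] by linarith
  then obtain n where n: "hnorm ip (x n - y) < \<epsilon> / 2"
    unfolding eventually_sequentially by blast
  have x: "x n \<in> H" "\<exists>z\<in>cfun.span S. hnorm ip (x n - z) < \<epsilon> / 2"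
    using assms(2)[of n] half_gt_zero[OF \<open>\<epsilon> > 0\<close>] in_hclosure_iff[OF hs_span[OF assms(1)]]
    unfolding closed_span_def by blast+
  then obtain z where z: "z \<in> cfun.span S" "hnorm ip (x n - z) < \<epsilon> / 2" by blast
  then have "z \<in> H" using hs_span[OF assms(1)] by blast
  then have "hnorm ip (y - z) < \<epsilon>"
    using hnorm_triangle_diff[of y "x n" z] n z x(1) assms(3) hnorm_minus_commute[of y "x n"] by simp
  then show "\<exists>z\<in>cfun.span S. hnorm ip (y - z) < \<epsilon>" using z(1) by blast
qed

lemma closed_span_subset: "S \<subseteq> H \<Longrightarrow> closed_span H ip S \<subseteq> H"
  by (simp add: closed_span_def hclosure_subset hs_span)

lemma span_subset_closed_span: "S \<subseteq> H \<Longrightarrow> cfun.span S \<subseteq> closed_span H ip S"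
  by (simp add: closed_span_def subset_hclosure hs_span)

lemma closed_span_add:
  assumes S: "S \<subseteq> H" and xy: "x \<in> closed_span H ip S" "y \<in> closed_span H ip S"
  shows "x + y \<in> closed_span H ip S"
proof -
  note iff = in_hclosure_iff[OF hs_span[OF S], folded closed_span_def]
  have H: "x \<in> H" "y \<in> H" using xy iff by auto
  have "\<exists>z\<in>cfun.span S. hnorm ip (x + y - z) < \<epsilon>" if \<epsilon>: "\<epsilon> > 0" for \<epsilon>
  proof -
    obtain a b where ab: "a \<in> cfun.span S" "b \<in> cfun.span S"
      "hnorm ip (x - a) < \<epsilon> / 2" "hnorm ip (y - b) < \<epsilon> / 2"
      using xy iff \<epsilon> half_gt_zero by metis
    have abH: "a \<in> H" "b \<in> H" using ab hs_span[OF S] by auto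
    have eq: "x + y - (a + b) = (x - a) + (y - b)" by (simp add: algebra_simps)
    have "hnorm ip (x + y - (a + b)) < \<epsilon>"
      unfolding eq using hnorm_triangle[of "x - a" "y - b"] ab H abH by (simp add: hs_diff)
    then show ?thesis using ab cfun.span_add by blast
  qed
  then show ?thesis using iff H hs_add by blast
qed

lemma closed_span_scale:
  assumes S: "S \<subseteq> H" and x: "x \<in> closed_span H ip S"
  shows "cscale c x \<in> closed_span H ip S"
proof -
  note iff = in_hclosure_iff[OF hs_span[OF S], folded closed_span_def]
  have H: "x \<in> H" using x iff by auto
  have "\<exists>z\<in>cfun.span S. hnorm ip (cscale c x - z) < \<epsilon>" if \<epsilon>: "\<epsilon> > 0" for \<epsilon>
  proof -
    have "\<epsilon> / (1 + cmod c) > 0" using \<epsilon> by (simp add: add_pos_nonneg)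
    then obtain a where a: "a \<in> cfun.span S" "hnorm ip (x - a) < \<epsilon> / (1 + cmod c)"
      using x iff by metis
    have aH: "a \<in> H" using a hs_span[OF S] by auto
    have "hnorm ip (cscale c x - cscale c a) = cmod c * hnorm ip (x - a)"
      using H aH by (simp flip: cfun.scale_right_diff_distrib add: hnorm_scale hs_diff)
    also have "\<dots> \<le> (1 + cmod c) * hnorm ip (x - a)"
      using H aH hnorm_ge0 hs_diff by (simp add: mult_right_mono)
    also have "\<dots> < \<epsilon>" using a(2) by (simp add: field_simps add_pos_nonneg)
    finally show ?thesis using a(1) cfun.span_scale by blast
  qed
  then show ?thesis using iff H hs_scale by blast
qed

text \<open>A sequence in the closed span that minimises the distance to \<open>f\<close> is Cauchy
  by the parallelogram law. Its limit \<open>m\<close> attains the distance, and a component of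
  \<open>f - m\<close> along some \<open>y\<close> could be subtracted to come nearer still.\<close>

lemma closed_span_projection:
  assumes S: "S \<subseteq> H" and f: "f \<in> H"
  shows "\<exists>m\<in>closed_span H ip S. \<forall>x\<in>closed_span H ip S. ip x (f - m) = 0"
proof -
  define K where "K = closed_span H ip S"
  have KH: "K \<subseteq> H" using closed_span_subset[OF S] by (simp add: K_def)
  have K0: "0 \<in> K" using span_subset_closed_span[OF S] cfun.span_zero K_def by auto
  have Kadd: "x \<in> K \<Longrightarrow> y \<in> K \<Longrightarrow> x + y \<in> K" for x y
    using closed_span_add[OF S] K_def by blast
  have Kscale: "x \<in> K \<Longrightarrow> cscale c x \<in> K" for x c
    using closed_span_scale[OF S] K_def by blast
  define D where "D = (\<lambda>x. hnorm ip (f - x)) ` K"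
  define d where "d = Inf D"
  have bdd: "bdd_below D" using KH f hnorm_ge0 hs_diff
    by (intro bdd_belowI[of _ 0]) (auto simp: D_def)
  have ne: "D \<noteq> {}" using K0 by (auto simp: D_def)
  have d_le: "d \<le> hnorm ip (f - x)" if "x \<in> K" for x
    unfolding d_def using that bdd by (intro cInf_lower) (auto simp: D_def)
  have d0: "d \<ge> 0" unfolding d_def using ne KH f hnorm_ge0 hs_diff
    by (intro cInf_greatest) (auto simp: D_def)
  have "\<exists>x\<in>K. hnorm ip (f - x) < d + 1 / Suc n" for n
    using cInf_lessD[OF ne, of "d + 1 / Suc n"] by (force simp: d_def D_def)
  then obtain x where xK: "\<And>n. x n \<in> K" and xd: "\<And>n. hnorm ip (f - x n) < d + 1 / Suc n"
    by metis
  have xH: "x n \<in> H" for n using xK KH by blast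
  text \<open>Parallelogram law for \<open>f - x m\<close> and \<open>f - x n\<close>, whose midpoint is again of the form \<open>f - k\<close>.\<close>
  have para: "(hnorm ip (x m - x n))\<^sup>2 \<le> 2 * (hnorm ip (f - x m))\<^sup>2 + 2 * (hnorm ip (f - x n))\<^sup>2 - 4 * d\<^sup>2" for m n
  proof -
    define a where "a = f - x m"
    define b where "b = f - x n"
    have ab: "a \<in> H" "b \<in> H" using f xH by (auto simp: a_def b_def hs_diff)
    define k where "k = cscale (1/2) (x m + x n)"
    have k: "k \<in> K" using xK Kadd Kscale by (simp add: k_def)
    have "a + b = cscale 2 (f - k)"
      by (auto simp: a_def b_def k_def cscale_def fun_eq_iff field_simps)
    then have "hnorm ip (a + b) = 2 * hnorm ip (f - k)"
      using f k KH by (simp add: hnorm_scale hs_diff subset_eq)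
    then have "2 * d \<le> hnorm ip (a + b)" using d_le[OF k] by simp
    then have "(2 * d)\<^sup>2 \<le> (hnorm ip (a + b))\<^sup>2" using d0 by (intro power_mono) auto
    moreover have "(hnorm ip (a + b))\<^sup>2 + (hnorm ip (a - b))\<^sup>2 = 2 * (hnorm ip a)\<^sup>2 + 2 * (hnorm ip b)\<^sup>2"
      using hnorm_add_sq[OF ab] hnorm_diff_sq[OF ab] by simp
    moreover have "hnorm ip (a - b) = hnorm ip (x m - x n)"
      using hnorm_minus_commute[OF xH xH] by (simp add: a_def b_def)
    ultimately show ?thesis by (simp add: a_def b_def)
  qed
  have "\<exists>N. \<forall>m\<ge>N. \<forall>n\<ge>N. hnorm ip (x m - x n) < \<epsilon>" if "\<epsilon> > 0" for \<epsilon>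
  proof -
    have "(\<lambda>n. (d + 1 / real (Suc n))\<^sup>2) \<longlonglongrightarrow> (d + 0)\<^sup>2"
      by (intro tendsto_intros LIMSEQ_Suc[OF lim_1_over_n])
    \<comment> \<open>The margin \<epsilon>^2 / 4 enters the parallelogram bound twice with factor
      2, so it adds up to \<epsilon>^2.\<close>
    then have "eventually (\<lambda>n. (d + 1 / real (Suc n))\<^sup>2 < d\<^sup>2 + \<epsilon>\<^sup>2 / 4) sequentially"
      using that by (intro order_tendstoD) auto
    then obtain N where N: "\<And>n. n \<ge> N \<Longrightarrow> (d + 1 / real (Suc n))\<^sup>2 < d\<^sup>2 + \<epsilon>\<^sup>2 / 4"
      by (auto simp: eventually_sequentially)
    have near: "(hnorm ip (f - x n))\<^sup>2 < d\<^sup>2 + \<epsilon>\<^sup>2 / 4" if "n \<ge> N" for n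
    proof -
      have "(hnorm ip (f - x n))\<^sup>2 \<le> (d + 1 / real (Suc n))\<^sup>2"
        using xd[of n] hnorm_ge0[of "f - x n"] f xH hs_diff by (intro power_mono) auto
      then show ?thesis using N[OF that] by linarith
    qed
    have "hnorm ip (x m - x n) < \<epsilon>" if "m \<ge> N" "n \<ge> N" for m n
    proof (rule power2_less_imp_less)
      show "(hnorm ip (x m - x n))\<^sup>2 < \<epsilon>\<^sup>2"
        using para[of m n] near[OF that(1)] near[OF that(2)] by linarith
    qed (use \<open>\<epsilon> > 0\<close> in auto)
    then show ?thesis by blast
  qed
  then obtain m where m: "m \<in> H" "(\<lambda>n. hnorm ip (x n - m)) \<longlonglongrightarrow> 0"
    using hnorm_Cauchy_converges[of x] xH by blast
  have mK: "m \<in> K" using closed_span_closed[OF S _ m] xK K_def by blast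
  have "hnorm ip (f - m) \<le> d"
  proof (rule LIMSEQ_le_const)
    show "(\<lambda>n. (d + 1 / real (Suc n)) + hnorm ip (x n - m)) \<longlonglongrightarrow> d"
      using tendsto_add[OF tendsto_add[OF tendsto_const LIMSEQ_Suc[OF lim_1_over_n]] m(2)] by simp
    show "\<exists>N. \<forall>n\<ge>N. hnorm ip (f - m) \<le> d + 1 / real (Suc n) + hnorm ip (x n - m)"
      using hnorm_triangle_diff[OF f xH m(1)] xd by (meson add_mono less_imp_le order_trans order_refl)
  qed
  then have md: "hnorm ip (f - m) = d" using d_le[OF mK] by simp
  define g where "g = f - m"
  have gH: "g \<in> H" using f m hs_diff by (simp add: g_def)
  have gd: "hnorm ip g = d" using md by (simp add: g_def)
  have "ip y (g) = 0" if y: "y \<in> K" for y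
  proof (rule ccontr)
    assume ne0: "ip y (g) \<noteq> 0"
    have yH: "y \<in> H" using y KH by blast
    have y0: "y \<noteq> 0" using ne0 ip_zero_left gH by auto
    define n where "n = (hnorm ip y)\<^sup>2"
    have n: "n > 0" using y0 yH hnorm_eq0 by (simp add: n_def)
    define a where "a = ip (g) y / of_real n"
    have "m + cscale a y \<in> K" using Kadd mK Kscale y by blast
    then have "d \<le> hnorm ip (g - cscale a y)"
      using d_le by (fastforce simp: g_def algebra_simps)
    then have "d\<^sup>2 \<le> (hnorm ip (g - cscale a y))\<^sup>2" using d0 by (intro power_mono)
    also have "\<dots> = d\<^sup>2 - 2 * Re (cnj a * ip (g) y) + (cmod a)\<^sup>2 * n"
      using gH yH gd by (simp add: hnorm_diff_sq hs_scale hnorm_scale ip_scale_right n_def power_mult_distrib)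
    also have "cnj a * ip (g) y = complex_of_real ((cmod (ip (g) y))\<^sup>2 / n)"
      using complex_norm_square[of "ip (g) y"] by (simp add: a_def mult.commute)
    also have "(cmod a)\<^sup>2 * n = (cmod (ip (g) y))\<^sup>2 / n"
      using n by (simp add: a_def norm_divide power2_eq_square)
    finally have "(cmod (ip (g) y))\<^sup>2 / n \<le> 0" by simp
    then have "ip (g) y = 0" using n by (simp add: divide_le_0_iff)
    then show False using ne0 ip_commute[OF gH yH] by simp
  qed
  then show ?thesis using mK unfolding K_def g_def by blast
qed

lemma tendsto_ip_left:
  assumes x: "\<And>n::nat. x n \<in> H" and y: "y \<in> H" and h: "h \<in> H"
    and lim: "(\<lambda>n. hnorm ip (x n - y)) \<longlonglongrightarrow> 0"
  shows "(\<lambda>n. ip (x n) h) \<longlonglongrightarrow> ip y h"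
proof (rule LIM_zero_cancel, rule Lim_null_comparison)
  show "\<forall>\<^sub>F n in sequentially. norm (ip (x n) h - ip y h) \<le> hnorm ip (x n - y) * hnorm ip h"
    using cauchy_schwarz[OF hs_diff[OF x y] h] x y h
    by (intro always_eventually allI) (simp add: ip_diff_left)
  show "(\<lambda>n. hnorm ip (x n - y) * hnorm ip h) \<longlonglongrightarrow> 0"
    using tendsto_mult_right[OF lim, of "hnorm ip h"] by simp
qed

lemma tendsto_ip_right:
  assumes x: "\<And>n::nat. x n \<in> H" and y: "y \<in> H" and h: "h \<in> H"
    and lim: "(\<lambda>n. hnorm ip (x n - y)) \<longlonglongrightarrow> 0"
  shows "(\<lambda>n. ip h (x n)) \<longlonglongrightarrow> ip h y"
  using tendsto_cnj[OF tendsto_ip_left[OF x y h lim]] ip_commute[OF x h] ip_commute[OF y h] by simp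

section \<open>Orthonormal and Riesz expansions\<close>

context
  fixes e :: "nat \<Rightarrow> complex \<Rightarrow> complex"
  assumes onb: "orthonormal_basis H ip UNIV e"
begin

lemma onb_in: "e n \<in> H"
  using onb by (auto simp: orthonormal_basis_def complete_system_def)

lemma onb_ip: "ip (e n) (e m) = (if n = m then 1 else 0)"
  using onb by (simp add: orthonormal_basis_def)

lemma onb_sum_in: "(\<Sum>n\<in>I. cscale (a n) (e n)) \<in> H"
  by (simp add: hs_sum hs_scale onb_in)

lemma onb_sum_ip:
  assumes "finite I"
  shows "ip (\<Sum>n\<in>I. cscale (a n) (e n)) (e m) = (if m \<in> I then a m else 0)"
proof -
  have "ip (\<Sum>n\<in>I. cscale (a n) (e n)) (e m) = (\<Sum>n\<in>I. a n * ip (e n) (e m))"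
    by (simp add: ip_sum_left hs_scale onb_in ip_scale_left)
  also have "\<dots> = (\<Sum>n\<in>I. if n = m then a n else 0)"
    by (intro sum.cong) (auto simp: onb_ip)
  finally show ?thesis using assms by (simp add: sum.delta)
qed

lemma onb_sum_norm:
  assumes "finite I"
  shows "(hnorm ip (\<Sum>n\<in>I. cscale (a n) (e n)))\<^sup>2 = (\<Sum>n\<in>I. (cmod (a n))\<^sup>2)"
proof -
  let ?s = "\<Sum>n\<in>I. cscale (a n) (e n)"
  have "ip ?s ?s = (\<Sum>m\<in>I. ip ?s (cscale (a m) (e m)))"
    by (intro ip_sum_right hs_scale onb_in onb_sum_in)
  also have "\<dots> = (\<Sum>m\<in>I. cnj (a m) * ip ?s (e m))"
    by (intro sum.cong refl ip_scale_right onb_in onb_sum_in)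
  also have "\<dots> = (\<Sum>m\<in>I. complex_of_real ((cmod (a m))\<^sup>2))"
    using assms complex_norm_square by (intro sum.cong refl) (simp add: onb_sum_ip mult.commute)
  finally have "ip ?s ?s = complex_of_real (\<Sum>m\<in>I. (cmod (a m))\<^sup>2)" by simp
  then show ?thesis using ip_self[OF onb_sum_in[of a I]] of_real_eq_iff by metis
qed

lemma onb_bessel:
  assumes x: "x \<in> H" and "finite I"
  shows "(\<Sum>n\<in>I. (cmod (ip x (e n)))\<^sup>2) \<le> (hnorm ip x)\<^sup>2"
proof -
  let ?s = "\<Sum>n\<in>I. cscale (ip x (e n)) (e n)"
  have "ip x ?s = (\<Sum>m\<in>I. ip x (cscale (ip x (e m)) (e m)))"
    by (intro ip_sum_right hs_scale onb_in x)
  also have "\<dots> = (\<Sum>m\<in>I. cnj (ip x (e m)) * ip x (e m))"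
    by (intro sum.cong refl ip_scale_right onb_in x)
  also have "\<dots> = (\<Sum>m\<in>I. complex_of_real ((cmod (ip x (e m)))\<^sup>2))"
    using complex_norm_square by (intro sum.cong refl) (simp add: mult.commute)
  finally have "Re (ip x ?s) = (\<Sum>n\<in>I. (cmod (ip x (e n)))\<^sup>2)" by simp
  moreover have "0 \<le> (hnorm ip (x - ?s))\<^sup>2" by simp
  ultimately show ?thesis
    using hnorm_diff_sq[OF x onb_sum_in[of "\<lambda>n. ip x (e n)" I]]
      onb_sum_norm[OF assms(2), of "\<lambda>n. ip x (e n)"] by linarith
qed

lemma onb_summable: "x \<in> H \<Longrightarrow> summable (\<lambda>n. (cmod (ip x (e n)))\<^sup>2)"
  by (rule summableI_nonneg_bounded[of _ "(hnorm ip x)\<^sup>2"]) (auto intro: onb_bessel)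

text \<open>Bessel's inequality makes the partial sums Cauchy before their limit is known. The limit
  has the same coefficients as \<open>x\<close>, and completeness of the system rules out a
  difference.\<close>

lemma onb_expansion:
  assumes x: "x \<in> H"
  shows "(\<lambda>N. hnorm ip ((\<Sum>n<N. cscale (ip x (e n)) (e n)) - x)) \<longlonglongrightarrow> 0"
proof -
  define s where "s = (\<lambda>N. \<Sum>n<N. cscale (ip x (e n)) (e n))"
  have sH: "s N \<in> H" for N unfolding s_def by (rule onb_sum_in)
  have "\<exists>N. \<forall>m\<ge>N. \<forall>n\<ge>N. hnorm ip (s m - s n) < \<epsilon>" if "\<epsilon> > 0" for \<epsilon>
  proof -
    have "\<epsilon>\<^sup>2 > 0" using that by simp
    then obtain N where N: "\<And>m n. m \<ge> N \<Longrightarrow> norm (\<Sum>i\<in>{m..<n}. (cmod (ip x (e i)))\<^sup>2) < \<epsilon>\<^sup>2"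
      using onb_summable[OF x] unfolding summable_Cauchy by metis
    have le: "hnorm ip (s n - s m) < \<epsilon>" if "N \<le> m" "m \<le> n" for m n
    proof (rule power2_less_imp_less)
      have "s n = s m + (\<Sum>i\<in>{m..<n}. cscale (ip x (e i)) (e i))"
        unfolding s_def using that
        by (simp add: sum.atLeastLessThan_concat lessThan_atLeast0)
      then have "s n - s m = (\<Sum>i\<in>{m..<n}. cscale (ip x (e i)) (e i))" by (metis add_diff_cancel_left')
      then have "(hnorm ip (s n - s m))\<^sup>2 = (\<Sum>i\<in>{m..<n}. (cmod (ip x (e i)))\<^sup>2)"
        using onb_sum_norm[of "{m..<n}"] by simp
      also have "\<dots> < \<epsilon>\<^sup>2" using N[OF that(1), of n] by (simp add: sum_nonneg)
      finally show "(hnorm ip (s n - s m))\<^sup>2 < \<epsilon>\<^sup>2" .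
    qed (use \<open>\<epsilon> > 0\<close> in auto)
    have "hnorm ip (s m - s n) < \<epsilon>" if "m \<ge> N" "n \<ge> N" for m n
    proof (cases "m \<le> n")
      case True
      then show ?thesis using le[OF that(1) True] hnorm_minus_commute[OF sH sH] by simp
    next
      case False
      then show ?thesis using le[OF that(2)] by simp
    qed
    then show ?thesis by blast
  qed
  then obtain y where y: "y \<in> H" "(\<lambda>n. hnorm ip (s n - y)) \<longlonglongrightarrow> 0"
    using hnorm_Cauchy_converges[of s] sH by blast
  have "ip (e m) (x - y) = 0" for m
  proof -
    have "eventually (\<lambda>N. ip (s N) (e m) = ip x (e m)) sequentially"
      using eventually_gt_at_top[of m] by eventually_elim (simp add: s_def onb_sum_ip)
    then have "(\<lambda>N. ip (s N) (e m)) \<longlonglongrightarrow> ip x (e m)" by (rule tendsto_eventually)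
    then have "ip y (e m) = ip x (e m)"
      using tendsto_ip_left[OF sH y(1) onb_in y(2)] LIMSEQ_unique by blast
    then have "ip (x - y) (e m) = 0" using x y onb_in by (simp add: ip_diff_left)
    then show ?thesis using ip_commute[of "x - y" "e m"] x y onb_in hs_diff by simp
  qed
  then have "x - y = 0"
    using onb x y hs_diff complete_system_orthogonal_eq_0[of UNIV e "x - y"]
    unfolding orthonormal_basis_def by blast
  then show ?thesis using y(2) by (simp add: s_def)
qed

end

text \<open>Let \<open>\<kappa> n = A (e n)\<close> and \<open>h = A u\<close>. Applying
  \<open>A\<close> to the orthonormal expansion of \<open>u\<close> expands \<open>h\<close> in the
  vectors \<open>\<kappa> n\<close> with coefficients \<open>ip u (e n)\<close>; pairing with
  \<open>\<psi> m\<close> identifies them as \<open>ip h (\<psi> m)\<close>, and pairing with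
  \<open>f\<close> gives the last claim.\<close>

lemma riesz_basis_expansion:
  fixes \<kappa> :: "nat \<Rightarrow> complex \<Rightarrow> complex"
  assumes riesz: "riesz_basis H ip UNIV \<kappa>" and bio: "biorthogonal_system H ip UNIV \<kappa> \<psi>"
    and f: "f \<in> H" and h: "h \<in> H"
  shows "summable (\<lambda>n. (cmod (ip f (\<kappa> n)))\<^sup>2)"
    and "summable (\<lambda>n. (cmod (ip h (\<psi> n)))\<^sup>2)"
    and "(\<lambda>n. ip f (\<kappa> n) * cnj (ip h (\<psi> n))) sums ip f h"
proof -
  obtain e A where onb: "orthonormal_basis H ip UNIV e"
    and A: "bounded_invertible_operator H ip A" and \<kappa>: "\<And>n. \<kappa> n = A (e n)"
    using riesz by (auto simp: riesz_basis_def)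
  note eH = onb_in[OF onb]
  have bij: "bij_betw A H H"
    and A_add: "\<And>f g. f \<in> H \<Longrightarrow> g \<in> H \<Longrightarrow> A (f + g) = A f + A g"
    and A_scale: "\<And>c f. f \<in> H \<Longrightarrow> A (cscale c f) = cscale c (A f)"
    using A by (auto simp: bounded_invertible_operator_def)
  obtain C where "\<forall>f\<in>H. hnorm ip (A f) \<le> C * hnorm ip f"
    using A unfolding bounded_invertible_operator_def by blast
  then have C: "hnorm ip (A f) \<le> C * hnorm ip f" if "f \<in> H" for f using that by blast
  have AH: "A f \<in> H" if "f \<in> H" for f using bij that by (auto simp: bij_betw_def)
  have A0: "A 0 = 0" using A_scale[OF hs_zero, of 0] by (simp add: cscale_def zero_fun_def)
  have A_sum: "A (\<Sum>n\<in>I. cscale (a n) (e n)) = (\<Sum>n\<in>I. cscale (a n) (\<kappa> n))" if "finite I" for I a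
    using that
  proof induction
    case (insert n I)
    have "A (cscale (a n) (e n) + (\<Sum>n\<in>I. cscale (a n) (e n))) =
        cscale (a n) (\<kappa> n) + A (\<Sum>n\<in>I. cscale (a n) (e n))"
      by (simp only: A_add hs_scale eH onb_sum_in[OF onb] A_scale \<kappa>)
    then show ?case
      using insert.IH sum.insert[OF insert.hyps, of "\<lambda>n. cscale (a n) (e n)"]
        sum.insert[OF insert.hyps, of "\<lambda>n. cscale (a n) (\<kappa> n)"] by argo
  next
    case empty
    then show ?case using A0 by (simp only: sum.empty)
  qed
  have \<kappa>H: "\<kappa> n \<in> H" for n using AH eH \<kappa> by simp
  have ip_sum: "ip f (\<Sum>n<N. cscale (a n) (\<kappa> n)) = (\<Sum>n<N. cnj (a n) * ip f (\<kappa> n))" for a N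
  proof -
    have "ip f (\<Sum>n<N. cscale (a n) (\<kappa> n)) = (\<Sum>n<N. ip f (cscale (a n) (\<kappa> n)))"
      by (intro ip_sum_right hs_scale \<kappa>H f)
    also have "\<dots> = (\<Sum>n<N. cnj (a n) * ip f (\<kappa> n))"
      by (intro sum.cong refl ip_scale_right \<kappa>H f)
    finally show ?thesis .
  qed
  show "summable (\<lambda>n. (cmod (ip f (\<kappa> n)))\<^sup>2)"
  proof (rule summableI_nonneg_bounded)
    fix N
    \<comment> \<open>Pairing \<open>f\<close> with the image of the vector that has the unknown
      numbers themselves as coefficients replaces the adjoint of \<open>A\<close>: the square sum
      \<open>T\<close> is at most \<open>hnorm ip f * C * sqrt T\<close>.\<close>
    define a where "a = (\<lambda>n. ip f (\<kappa> n))"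
    define v where "v = (\<Sum>n<N. cscale (a n) (e n))"
    define T where "T = (\<Sum>n<N. (cmod (a n))\<^sup>2)"
    have vH: "v \<in> H" unfolding v_def by (rule onb_sum_in[OF onb])
    have T0: "T \<ge> 0" by (simp add: T_def sum_nonneg)
    have "ip f (A v) = (\<Sum>n<N. cnj (a n) * a n)"
      unfolding v_def A_sum[OF finite_lessThan] ip_sum by (simp add: a_def)
    also have "\<dots> = (\<Sum>n<N. complex_of_real ((cmod (a n))\<^sup>2))"
      using complex_norm_square by (intro sum.cong refl) (simp add: mult.commute)
    also have "\<dots> = complex_of_real T" by (simp add: T_def)
    finally have "cmod (ip f (A v)) = T" using T0 by simp
    then have "T \<le> hnorm ip f * hnorm ip (A v)" using cauchy_schwarz[OF f AH[OF vH]] by simp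
    also have "\<dots> \<le> hnorm ip f * (C * hnorm ip v)"
      by (intro mult_left_mono C vH hnorm_ge0 f)
    also have "hnorm ip v = sqrt T"
      using onb_sum_norm[OF onb, of "{..<N}" a] hnorm_ge0[OF vH] by (simp add: v_def T_def real_sqrt_unique)
    finally have "sqrt T * sqrt T \<le> (hnorm ip f * C) * sqrt T" using T0 by (simp add: mult.assoc)
    then have "sqrt T \<le> \<bar>hnorm ip f * C\<bar>"
    proof (cases "sqrt T = 0")
      case False
      then have "sqrt T > 0" using T0 by simp
      then have "sqrt T \<le> hnorm ip f * C"
        using \<open>sqrt T * sqrt T \<le> (hnorm ip f * C) * sqrt T\<close> by (rule mult_right_le_imp_le[rotated])
      then show ?thesis by linarith
    qed simp
    then have "T \<le> (hnorm ip f * C)\<^sup>2" using T0 by (metis abs_ge_zero power2_abs power_mono real_sqrt_ge_zero real_sqrt_pow2)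
    then show "(\<Sum>n<N. (cmod (ip f (\<kappa> n)))\<^sup>2) \<le> (hnorm ip f * C)\<^sup>2" by (simp add: T_def a_def)
  qed simp
  obtain u where u: "u \<in> H" "A u = h"
    by (metis bij bij_betw_imp_surj_on h imageE)
  define c where "c = (\<lambda>n. ip u (e n))"
  define s where "s = (\<lambda>N. \<Sum>n<N. cscale (c n) (e n))"
  have sH: "s N \<in> H" for N unfolding s_def by (rule onb_sum_in[OF onb])
  have As: "A (s N) = (\<Sum>n<N. cscale (c n) (\<kappa> n))" for N
    unfolding s_def by (rule A_sum) simp
  have AsH: "A (s N) \<in> H" for N using AH sH by blast
  have lim: "(\<lambda>N. hnorm ip (A (s N) - h)) \<longlonglongrightarrow> 0"
  proof (rule Lim_null_comparison)
    have "norm (hnorm ip (A (s N) - h)) \<le> C * hnorm ip (s N - u)" for N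
    proof -
      have "A (s N) = A (s N - u) + A u"
        using A_add[of "s N - u" u] sH u hs_diff by simp
      then have "A (s N) - h = A (s N - u)" using u by simp
      then show ?thesis using C[of "s N - u"] hnorm_ge0 AH sH u hs_diff by simp
    qed
    then show "\<forall>\<^sub>F N in sequentially. norm (hnorm ip (A (s N) - h)) \<le> C * hnorm ip (s N - u)"
      by simp
    show "(\<lambda>N. C * hnorm ip (s N - u)) \<longlonglongrightarrow> 0"
      using tendsto_mult_left[OF onb_expansion[OF onb u(1)], of C] by (simp add: s_def c_def)
  qed
  have \<psi>H: "\<psi> n \<in> H" and bio': "ip (\<kappa> n) (\<psi> m) = (if n = m then 1 else 0)" for n m
    using bio by (auto simp: biorthogonal_system_def)
  have coeff: "ip h (\<psi> m) = c m" for m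
  proof -
    have "ip (A (s N)) (\<psi> m) = c m" if "m < N" for N
    proof -
      have "ip (A (s N)) (\<psi> m) = (\<Sum>n<N. ip (cscale (c n) (\<kappa> n)) (\<psi> m))"
        unfolding As by (intro ip_sum_left hs_scale \<kappa>H \<psi>H)
      also have "\<dots> = (\<Sum>n<N. if n = m then c n else 0)"
        by (intro sum.cong refl) (simp add: ip_scale_left \<kappa>H \<psi>H bio')
      finally show ?thesis using that by (simp add: sum.delta)
    qed
    then have "eventually (\<lambda>N. ip (A (s N)) (\<psi> m) = c m) sequentially"
      by (intro eventually_mono[OF eventually_gt_at_top[of m]])
    then have "(\<lambda>N. ip (A (s N)) (\<psi> m)) \<longlonglongrightarrow> c m" by (rule tendsto_eventually)
    then show ?thesis
      using tendsto_ip_left[OF AsH h \<psi>H lim] LIMSEQ_unique by blast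
  qed
  show "summable (\<lambda>n. (cmod (ip h (\<psi> n)))\<^sup>2)"
    using onb_summable[OF onb u(1)] by (simp add: coeff c_def)
  show "(\<lambda>n. ip f (\<kappa> n) * cnj (ip h (\<psi> n))) sums ip f h"
    using tendsto_ip_right[OF AsH h f lim] unfolding sums_def As ip_sum coeff
    by (simp add: mult.commute)
qed

end

section \<open>Quotients of bounded holomorphic functions\<close>

text \<open>Write B = exp (- f) with Re f > 0. The Cayley map centred at \<open>f 0\<close> turns f
  into a self-map of the disc fixing 0, and the Schwarz lemma for it is Harnack's inequality for the
  positive harmonic function - ln |B|.\<close>

lemma harnack_lower_bound:
  assumes B: "B holomorphic_on ball 0 1" "\<And>z. cmod z < 1 \<Longrightarrow> B z \<noteq> 0"
    "\<And>z. cmod z < 1 \<Longrightarrow> cmod (B z) < 1"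
    and w: "cmod w < 1"
  shows "cmod (B 0) powr ((1 + cmod w) / (1 - cmod w)) \<le> cmod (B w)"
proof -
  obtain L where L: "L holomorphic_on ball 0 1" "\<And>z. z \<in> ball 0 1 \<Longrightarrow> exp (L z) = B z"
    by (rule holomorphic_logarithm_exists[of "ball 0 1" B 0]) (use B in auto)
  define f where "f = (\<lambda>z. - L z)"
  have f: "f holomorphic_on ball 0 1" unfolding f_def by (intro holomorphic_intros L)
  have Bf: "cmod (B z) = exp (- Re (f z))" if "cmod z < 1" for z
    using L(2)[of z] that by (simp add: f_def flip: norm_exp_eq_Re)
  have Ref: "Re (f z) > 0" if "cmod z < 1" for z
    using B(3)[OF that] Bf[OF that] by simp
  define \<psi> where "\<psi> = (\<lambda>z. (f z - f 0) / (f z + cnj (f 0)))"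
  have den: "f z + cnj (f 0) \<noteq> 0" if "cmod z < 1" for z
    using Ref[OF that] Ref[of 0] by (auto simp: complex_eq_iff)
  have hol: "\<psi> holomorphic_on ball 0 1"
    unfolding \<psi>_def by (intro holomorphic_intros f) (use den in auto)
  have less: "cmod (\<psi> z) < 1" if "cmod z < 1" for z
  proof -
    have "(cmod (f z + cnj (f 0)))\<^sup>2 - (cmod (f z - f 0))\<^sup>2 = 4 * Re (f z) * Re (f 0)"
      unfolding cmod_power2 by (simp add: power2_eq_square algebra_simps)
    moreover have "4 * Re (f z) * Re (f 0) > 0" using Ref[OF that] Ref[of 0] by simp
    ultimately have "(cmod (f z - f 0))\<^sup>2 < (cmod (f z + cnj (f 0)))\<^sup>2" by linarith
    then have "cmod (f z - f 0) < cmod (f z + cnj (f 0))"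
      by (rule power2_less_imp_less) simp
    then show ?thesis using den[OF that] by (simp add: \<psi>_def norm_divide)
  qed
  define \<rho> where "\<rho> = cmod w"
  have \<rho>: "0 \<le> \<rho>" "\<rho> < 1" using w by (auto simp: \<rho>_def)
  have "cmod (\<psi> w) \<le> \<rho>"
    unfolding \<rho>_def using Schwarz_Lemma(1)[OF hol _ less w] by (simp add: \<psi>_def)
  then have "cmod (f w - f 0) \<le> \<rho> * cmod (f w + cnj (f 0))"
    using den[OF w] by (simp add: \<psi>_def norm_divide divide_simps)
  then have "(cmod (f w - f 0))\<^sup>2 \<le> (\<rho> * cmod (f w + cnj (f 0)))\<^sup>2"
    by (intro power_mono) auto
  then have *: "(Re (f w) - Re (f 0))\<^sup>2 + (Im (f w) - Im (f 0))\<^sup>2 \<le>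
      \<rho>\<^sup>2 * ((Re (f w) + Re (f 0))\<^sup>2 + (Im (f w) - Im (f 0))\<^sup>2)"
    by (simp add: cmod_power2 power_mult_distrib)
  have "\<rho>\<^sup>2 \<le> 1" using \<rho> by (simp add: power_le_one)
  then have "\<rho>\<^sup>2 * (Im (f w) - Im (f 0))\<^sup>2 \<le> 1 * (Im (f w) - Im (f 0))\<^sup>2"
    by (intro mult_right_mono) auto
  then have "(Re (f w) - Re (f 0))\<^sup>2 \<le> (\<rho> * (Re (f w) + Re (f 0)))\<^sup>2"
    unfolding power_mult_distrib using *
    by (simp only: distrib_left mult_1_left)
  moreover have "0 \<le> \<rho> * (Re (f w) + Re (f 0))"
    using \<rho> Ref[OF w] Ref[of 0] by simp
  ultimately have "Re (f w) - Re (f 0) \<le> \<rho> * (Re (f w) + Re (f 0))"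
    using power2_le_imp_le by blast
  then have "Re (f w) * (1 - \<rho>) \<le> Re (f 0) * (1 + \<rho>)" by (simp add: algebra_simps)
  then have "Re (f w) \<le> (1 + \<rho>) / (1 - \<rho>) * Re (f 0)"
    using \<rho> by (simp add: field_simps)
  then have "exp (- ((1 + \<rho>) / (1 - \<rho>) * Re (f 0))) \<le> exp (- Re (f w))" by simp
  then show ?thesis
    using Bf[of 0] Bf[OF w] by (simp add: powr_def \<rho>_def)
qed

lemma max_modulus_disc:
  assumes "f holomorphic_on ball 0 R" "R > 1" "\<And>z. cmod z = 1 \<Longrightarrow> cmod (f z) \<le> M" "cmod w \<le> 1"
  shows "cmod (f w) \<le> M"
proof (rule maximum_modulus_frontier[of f "cball 0 1"])
  show "f holomorphic_on interior (cball 0 1)"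
    by (rule holomorphic_on_subset[OF assms(1)]) (use assms(2) in auto)
  show "continuous_on (closure (cball 0 1)) f"
    by (rule continuous_on_subset[OF holomorphic_on_imp_continuous_on[OF assms(1)]]) (use assms(2) in auto)
qed (use assms in auto)

text \<open>The full multiplicity of the zero is removed at once, so that the induction in
  \<open>quotient_bound_unit_disc\<close> can count distinct zeros.\<close>

lemma holomorphic_factor_power:
  assumes B: "B holomorphic_on S" and S: "open S" "connected S" and a: "a \<in> S"
    and nz: "\<exists>z\<in>S. B z \<noteq> 0"
  shows "\<exists>C m. C holomorphic_on S \<and> C a \<noteq> 0 \<and> (\<forall>z\<in>S. B z = (z - a) ^ m * C z)"
proof (cases "B a = 0")
  case False
  then show ?thesis using B by (intro exI[of _ B] exI[of _ 0]) auto
next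
  case True
  then have "\<not> B constant_on S" using nz a by (metis constant_on_def)
  then obtain g r m where g: "0 < r" "ball a r \<subseteq> S" "g holomorphic_on ball a r"
    "\<And>w. w \<in> ball a r \<Longrightarrow> B w = (w - a) ^ m * g w" "\<And>w. w \<in> ball a r \<Longrightarrow> g w \<noteq> 0" "m > 0"
    using holomorphic_factor_zero_nonconstant[OF B S a True] by metis
  define C where "C = (\<lambda>z. if z = a then g a else B z / (z - a) ^ m)"
  have "C holomorphic_on (S - {a}) \<union> ball a r"
  proof (rule holomorphic_on_Un)
    have "(\<lambda>z. B z / (z - a) ^ m) holomorphic_on S - {a}"
      by (intro holomorphic_intros holomorphic_on_subset[OF B]) auto
    then show "C holomorphic_on S - {a}"
      by (rule holomorphic_transform) (auto simp: C_def)
    show "C holomorphic_on ball a r"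
      by (rule holomorphic_transform[OF g(3)]) (use g(4) in \<open>auto simp: C_def\<close>)
  qed (use S in auto)
  moreover have "S - {a} \<union> ball a r = S" using a g by auto
  moreover have "B z = (z - a) ^ m * C z" if "z \<in> S" for z
    using True \<open>m > 0\<close> by (simp add: C_def)
  moreover have "C a \<noteq> 0" using g(1,5) by (simp add: C_def)
  ultimately show ?thesis by metis
qed

text \<open>Dividing \<open>B\<close> by the Blaschke factors of its zeros keeps both bounds on the circle and
  increases \<open>\<bar>B 0\<bar>\<close>; once \<open>B\<close> has no zeros, Harnack's inequality applies.\<close>

lemma quotient_bound_unit_disc:
  assumes S: "S holomorphic_on ball 0 R" and R: "R > 1"
    and B: "B holomorphic_on ball 0 R" "\<And>z. cmod z = 1 \<Longrightarrow> cmod (B z) \<le> 1"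
    "\<And>z. cmod z = 1 \<Longrightarrow> cmod (S z * B z) \<le> 1" "B 0 \<noteq> 0"
    and w: "cmod w < 1"
  shows "cmod (S w) \<le> (2 / cmod (B 0)) powr ((1 + cmod w) / (1 - cmod w))"
  using B
proof (induction "card {z \<in> ball 0 1. B z = 0}" arbitrary: B)
  case (0 B)
  note B = "0.prems"
  \<comment> \<open>\<open>card\<close> is 0 for infinite sets as well, so finiteness has to come
    before the conclusion that there are no zeros. The margin R > 1 makes the closed unit disc a
    compact part of the domain.\<close>
  have nc: "finite {z \<in> ball 0 1. B z = 0}"
  proof (cases "B constant_on ball 0 R")
    case True
    then obtain c where c: "\<And>z. z \<in> ball 0 R \<Longrightarrow> B z = c" unfolding constant_on_def by blast
    then have "c \<noteq> 0" using B(4) R by auto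
    then have "{z \<in> ball 0 1. B z = 0} = {}" using c R by auto
    then show ?thesis by (simp only: finite.emptyI)
  next
    case False
    then have "finite {z \<in> cball 0 1. B z = 0}"
      using R by (intro holomorphic_compact_finite_zeros[OF B(1)]) auto
    then show ?thesis by (rule rev_finite_subset) auto
  qed
  then have nz: "B z \<noteq> 0" if "cmod z < 1" for z
    using that 0(1) by auto
  define q where "q = (1 + cmod w) / (1 - cmod w)"
  have q: "q \<ge> 0" using w by (simp add: q_def)
  have le1: "cmod (B z) \<le> 1" if "cmod z \<le> 1" for z
    using max_modulus_disc[OF B(1) R B(2) that] by simp
  have SB: "cmod (S w * B w) \<le> 1"
    using max_modulus_disc[OF holomorphic_on_mult[OF S B(1)] R B(3)] w by simp
  \<comment> \<open>Halving \<open>B\<close> produces the strict bound that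
    \<open>harnack_lower_bound\<close> asks for; this is the origin of the 2 in the
    statement.\<close>
  have "cmod (B 0 / 2) powr q \<le> cmod (B w / 2)"
    unfolding q_def
  proof (rule harnack_lower_bound)
    show "(\<lambda>z. B z / 2) holomorphic_on ball 0 1"
      by (intro holomorphic_intros holomorphic_on_subset[OF B(1)]) (use R in auto)
    show "cmod (B z / 2) < 1" if "cmod z < 1" for z
      using le1[of z] that by (simp add: norm_divide)
  qed (use nz w in auto)
  then have low: "(cmod (B 0) / 2) powr q \<le> cmod (B w)"
    by (simp add: norm_divide) (smt (verit) norm_ge_zero)
  have "cmod (S w) = cmod (S w * B w) / cmod (B w)"
    using nz[OF w] by (simp add: norm_mult)
  also have "\<dots> \<le> 1 / (cmod (B 0) / 2) powr q"
    using low SB nz[of 0] by (intro frac_le) auto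
  also have "\<dots> = (2 / cmod (B 0)) powr q"
    using B(4) by (simp add: powr_divide)
  finally show ?case by (simp add: q_def)
next
  case (Suc n B)
  note B = Suc.prems
  have "card {z \<in> ball 0 1. B z = 0} \<noteq> 0" using Suc(2) by simp
  then have fin: "finite {z \<in> ball 0 1. B z = 0}" and "{z \<in> ball 0 1. B z = 0} \<noteq> {}"
    by (auto simp: card_eq_0_iff)
  then obtain a where a: "cmod a < 1" "B a = 0" by auto
  have "\<exists>C m. C holomorphic_on ball 0 R \<and> C a \<noteq> 0 \<and> (\<forall>z\<in>ball 0 R. B z = (z - a) ^ m * C z)"
    by (rule holomorphic_factor_power) (use B a R in auto)
  then obtain C m where C: "C holomorphic_on ball 0 R" "C a \<noteq> 0"
    and "\<forall>z\<in>ball 0 R. B z = (z - a) ^ m * C z" by blast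
  then have BC: "B z = (z - a) ^ m * C z" if "cmod z < R" for z using that by simp
  \<comment> \<open>The Blaschke quotient without fractions: each factor z - a becomes 1 - cnj a *
    z, of the same modulus on the circle. \<open>S\<close> is left untouched, and its bound passes
    from \<open>S * B\<close> to \<open>S * D\<close> since only moduli on the circle are
    involved.\<close>
  define D where "D = (\<lambda>z. (1 - cnj a * z) ^ m * C z)"
  have D: "D holomorphic_on ball 0 R" unfolding D_def by (intro holomorphic_intros C)
  have circ: "cmod (D z) = cmod (B z)" if "cmod z = 1" for z
  proof -
    have "z * cnj z = 1" using that by (simp add: complex_norm_square[symmetric])
    then have "1 - cnj a * z = z * cnj (z - a)" by (simp add: algebra_simps)
    then have "cmod (1 - cnj a * z) = cmod (z - a)"
      using that by (metis complex_mod_cnj mult_1 norm_mult)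
    then show ?thesis using that BC[of z] R by (simp add: D_def norm_mult norm_power)
  qed
  have ne: "1 - cnj a * z \<noteq> 0" if "cmod z < 1" for z
  proof
    assume "1 - cnj a * z = 0"
    then have "cmod (cnj a * z) = 1" by simp
    moreover have "cmod a * cmod z < 1 * 1" using a that by (intro mult_strict_mono') auto
    ultimately show False by (simp add: norm_mult)
  qed
  have Dz: "D z = 0 \<longleftrightarrow> B z = 0 \<and> z \<noteq> a" if "cmod z < 1" for z
    using ne[OF that] C(2) BC[of z] that R by (auto simp: D_def)
  then have "{z \<in> ball 0 1. D z = 0} = {z \<in> ball 0 1. B z = 0} - {a}" by auto
  then have card: "n = card {z \<in> ball 0 1. D z = 0}"
    using Suc(2) a fin by (simp add: card_Diff_singleton)
  have D0: "D 0 \<noteq> 0" using Dz[of 0] B(4) by simp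
  have "cmod (B 0) = cmod a ^ m * cmod (D 0)"
    using BC[of 0] R by (simp add: D_def norm_mult norm_power)
  also have "\<dots> \<le> 1 * cmod (D 0)"
    using a by (intro mult_right_mono) (auto simp: power_le_one)
  finally have le: "cmod (B 0) \<le> cmod (D 0)" by simp
  have "cmod (S w) \<le> (2 / cmod (D 0)) powr ((1 + cmod w) / (1 - cmod w))"
    by (rule Suc.hyps(1)[OF card D _ _ D0]) (use B(2,3) circ in \<open>auto simp: norm_mult\<close>)
  also have "\<dots> \<le> (2 / cmod (B 0)) powr ((1 + cmod w) / (1 - cmod w))"
    using le B(4) D0 w by (intro powr_mono2 divide_left_mono) auto
  finally show ?case .
qed

lemma quotient_bound_disc:
  assumes S: "S holomorphic_on ball c R" and g: "g holomorphic_on ball c R" and r: "0 < r" "r < R"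
    and M: "M > 0" "\<And>z. dist c z = r \<Longrightarrow> cmod (g z) \<le> M" "\<And>z. dist c z = r \<Longrightarrow> cmod (S z * g z) \<le> M"
    and gc: "g c \<noteq> 0" and w: "dist c w < r"
  shows "cmod (S w) \<le> (2 * M / cmod (g c)) powr ((r + dist c w) / (r - dist c w))"
proof -
  define h where "h = (\<lambda>z. c + of_real r * z)"
  define u where "u = (w - c) / of_real r"
  have hu: "h u = w" using r by (simp add: h_def u_def)
  have u: "cmod u = dist c w / r" using r by (simp add: u_def norm_divide dist_norm norm_minus_commute)
  have u1: "cmod u < 1" using u w r by simp
  have dist: "dist c (h z) = r * cmod z" for z
    using r by (simp add: h_def dist_norm norm_mult)
  have sub: "h ` ball 0 (R / r) \<subseteq> ball c R" using r by (auto simp: dist field_simps)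
  have h: "h holomorphic_on ball 0 (R / r)" unfolding h_def by (intro holomorphic_intros)
  have "cmod ((S \<circ> h) u) \<le> (2 / cmod ((\<lambda>z. (g \<circ> h) z / of_real M) 0)) powr ((1 + cmod u) / (1 - cmod u))"
  proof (rule quotient_bound_unit_disc[of _ "R / r"])
    show "(S \<circ> h) holomorphic_on ball 0 (R / r)"
      by (rule holomorphic_on_compose_gen[OF h S sub])
    have "(g \<circ> h) holomorphic_on ball 0 (R / r)"
      by (rule holomorphic_on_compose_gen[OF h g sub])
    then show "(\<lambda>z. (g \<circ> h) z / of_real M) holomorphic_on ball 0 (R / r)"
      by (rule holomorphic_on_divide) (use M in auto)
    show "cmod ((g \<circ> h) z / of_real M) \<le> 1" if "cmod z = 1" for z
      using M(2)[of "h z"] M(1) that by (simp add: dist norm_divide)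
    show "cmod ((S \<circ> h) z * ((g \<circ> h) z / of_real M)) \<le> 1" if "cmod z = 1" for z
      using M(3)[of "h z"] M(1) that by (simp add: dist norm_divide norm_mult)
    show "(g \<circ> h) 0 / of_real M \<noteq> 0" using gc M by (simp add: h_def)
  qed (use r u1 in auto)
  moreover have "(1 + cmod u) / (1 - cmod u) = (r + dist c w) / (r - dist c w)"
    using r w by (simp add: u field_simps)
  ultimately show ?thesis using hu M by (simp add: norm_divide) (simp add: h_def)
qed

section \<open>Crossing the real line\<close>

lemma Re_inverse_square_lower:
  fixes u :: complex
  assumes "0 < Re u" "2 * \<bar>Im u\<bar> \<le> Re u"
  shows "Re (1 / u\<^sup>2) \<ge> 12 / 25 / (Re u)\<^sup>2"
proof -
  define a where "a = (Re u)\<^sup>2"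
  define b where "b = (Im u)\<^sup>2"
  have a: "a > 0" using assms by (simp add: a_def)
  have "\<bar>2 * Im u\<bar>\<^sup>2 \<le> (Re u)\<^sup>2" using assms by (intro power_mono) auto
  then have ba: "4 * b \<le> a" by (simp add: a_def b_def power_mult_distrib)
  have b: "b \<ge> 0" by (simp add: b_def)
  have "Re (1 / u\<^sup>2) = (a - b) / (a + b)\<^sup>2"
  proof -
    have "Re (1 / u\<^sup>2) = Re (u\<^sup>2) / (cmod (u\<^sup>2))\<^sup>2" by (simp add: Re_divide cmod_power2)
    also have "Re (u\<^sup>2) = a - b" by (simp add: a_def b_def power2_eq_square)
    also have "cmod (u\<^sup>2) = a + b" by (simp add: norm_power cmod_power2 a_def b_def)
    finally show ?thesis .
  qed
  \<comment> \<open>The quotient decreases in \<open>b\<close>, so the worst case is the edge b = a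
    / 4 of the sector, where (3/4) / (5/4)^2 = 12/25.\<close>
  also have "\<dots> \<ge> 12 / 25 / a"
  proof -
    have "(a + b)\<^sup>2 \<le> (5 / 4 * a)\<^sup>2" using ba a b by (intro power_mono) auto
    then have "12 * (a + b)\<^sup>2 \<le> 25 * a * (3 / 4 * a)" by (simp add: power2_eq_square)
    also have "\<dots> \<le> 25 * a * (a - b)" using ba a by (intro mult_left_mono) auto
    finally show ?thesis using a b by (simp add: divide_simps) (simp add: algebra_simps)
  qed
  finally show ?thesis by (simp add: a_def)
qed

text \<open>The barrier \<open>exp (- 9 L (1/(1-z)\<^sup>2 + 1/(1+z)\<^sup>2))\<close> compensates the growth of \<open>f\<close> on the
  rhombus with vertices \<open>\<plusminus>1\<close> and \<open>\<plusminus>\<i>/2\<close>; the truncation at \<open>\<bar>Re z\<bar> = 1 - \<eta>\<close> avoids its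
  singularities.\<close>

lemma rhombus_bound:
  assumes f: "f holomorphic_on UNIV" and L: "L \<ge> 1"
    and bound: "\<And>z. \<bar>Re z\<bar> \<le> 1 \<Longrightarrow> Im z \<noteq> 0 \<Longrightarrow> \<bar>Im z\<bar> \<le> 1 \<Longrightarrow> cmod (f z) \<le> exp (L / (Im z)\<^sup>2)"
    and w: "Re w = 0" "\<bar>Im w\<bar> \<le> 1 / 4"
  shows "cmod (f w) \<le> exp (18 * L)"
proof -
  define E where "E = (\<lambda>z::complex. 1 / (1 - z)\<^sup>2 + 1 / (1 + z)\<^sup>2)"
  define \<phi> where "\<phi> = (\<lambda>z. f z * exp (- of_real (9 * L) * E z))"
  have fc: "continuous_on UNIV f" using f holomorphic_on_imp_continuous_on by blast
  have "bounded (f ` cball 0 2)"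
    by (intro compact_imp_bounded compact_continuous_image continuous_on_subset[OF fc]) auto
  then obtain N where N: "\<And>z. cmod z \<le> 2 \<Longrightarrow> cmod (f z) \<le> N" "N > 0"
    by (force simp: bounded_pos)
  \<comment> \<open>\<open>N\<close> depends on \<open>f\<close>, which the final bound must not.
    Cutting the tips off at distance \<eta> makes ln N at most 1 / \<eta>^2, which the barrier
    outweighs on the vertical sides.\<close>
  define \<eta> where "\<eta> = min (1 / 2) (1 / sqrt (1 + \<bar>ln N\<bar>))"
  have \<eta>: "0 < \<eta>" "\<eta> \<le> 1 / 2" by (auto simp: \<eta>_def)
  have \<eta>2: "\<bar>ln N\<bar> \<le> 1 / \<eta>\<^sup>2"
  proof -
    have "\<eta>\<^sup>2 \<le> (1 / sqrt (1 + \<bar>ln N\<bar>))\<^sup>2" using \<eta> by (intro power_mono) (auto simp: \<eta>_def)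
    also have "\<dots> = 1 / (1 + \<bar>ln N\<bar>)" by (simp add: power_divide)
    finally have "\<eta>\<^sup>2 * (1 + \<bar>ln N\<bar>) \<le> 1" by (simp add: field_simps)
    then have "\<bar>ln N\<bar> * \<eta>\<^sup>2 \<le> 1" using \<eta> by (simp add: algebra_simps) (smt (verit) zero_le_power2)
    then show ?thesis using \<eta> by (simp add: field_simps)
  qed
  define U where "U = {z. \<bar>Re z\<bar> \<le> 1 - \<eta> \<and> 2 * \<bar>Im z\<bar> \<le> 1 - \<bar>Re z\<bar>}"
  have closedU: "closed U" unfolding U_def
    by (intro closed_Collect_conj closed_Collect_le continuous_intros)
  have smallU: "cmod z \<le> 2" if "z \<in> U" for z
    using cmod_le[of z] that \<eta> by (auto simp: U_def)
  then have boundedU: "bounded U" by (auto simp: bounded_iff)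
  have ne: "1 - z \<noteq> 0" "1 + z \<noteq> 0" if "z \<in> U" for z
    using that \<eta> by (auto simp: U_def complex_eq_iff)
  have hol: "\<phi> holomorphic_on U" unfolding \<phi>_def E_def
    by (intro holomorphic_intros holomorphic_on_subset[OF f]) (use ne in auto)
  have ReE: "Re (E z) \<ge> 12 / 25 / (1 - \<bar>Re z\<bar>)\<^sup>2" if "z \<in> U" for z
  proof -
    have 1: "0 < Re (1 - z)" "2 * \<bar>Im (1 - z)\<bar> \<le> Re (1 - z)"
      "0 < Re (1 + z)" "2 * \<bar>Im (1 + z)\<bar> \<le> Re (1 + z)"
      using that \<eta> by (auto simp: U_def)
    have "0 \<le> 12 / 25 / (Re (1 - z))\<^sup>2" "0 \<le> 12 / 25 / (Re (1 + z))\<^sup>2" by simp_all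
    moreover have "\<bar>Re z\<bar> = Re z \<or> \<bar>Re z\<bar> = - Re z" by linarith
    then have "12 / 25 / (1 - \<bar>Re z\<bar>)\<^sup>2 = 12 / 25 / (Re (1 - z))\<^sup>2 \<or>
      12 / 25 / (1 - \<bar>Re z\<bar>)\<^sup>2 = 12 / 25 / (Re (1 + z))\<^sup>2" by auto
    ultimately show ?thesis
      using Re_inverse_square_lower[OF 1(1,2)] Re_inverse_square_lower[OF 1(3,4)]
      unfolding E_def plus_complex.sel by linarith
  qed
  have norm\<phi>: "cmod (\<phi> z) = cmod (f z) * exp (- (9 * L * Re (E z)))" for z
    by (simp add: \<phi>_def norm_mult)
  have "cmod (\<phi> w) \<le> 1"
  proof (rule maximum_modulus_frontier[of \<phi> U])
    show "\<phi> holomorphic_on interior U" using hol holomorphic_on_subset interior_subset by blast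
    show "continuous_on (closure U) \<phi>" using hol closedU by (simp add: holomorphic_on_imp_continuous_on)
    show "w \<in> U" using w \<eta> by (auto simp: U_def)
    fix z assume "z \<in> frontier U"
    then have z: "z \<in> U" "z \<notin> interior U" using closedU by (auto simp: frontier_def)
    define d where "d = 1 - \<bar>Re z\<bar>"
    have d: "\<eta> \<le> d" "d \<le> 1" "2 * \<bar>Im z\<bar> \<le> d" using z(1) by (auto simp: U_def d_def)
    have "d\<^sup>2 > 0" using d \<eta> by simp
    \<comment> \<open>On the slanted sides |Im z| = d / 2, so the growth exponent of
      \<open>f\<close> is 4 * L / d^2. The factor 9 is the least integer with 9 * 12 / 25 >=
      4.\<close>
    have E9: "4 * L / d\<^sup>2 \<le> 9 * L * Re (E z)"
    proof -
      have "4 * L / d\<^sup>2 \<le> 9 * L * (12 / 25 / d\<^sup>2)" using L \<open>d\<^sup>2 > 0\<close> by (simp add: field_simps)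
      also have "\<dots> \<le> 9 * L * Re (E z)" using ReE[OF z(1)] L by (intro mult_left_mono) (auto simp: d_def)
      finally show ?thesis .
    qed
    have "\<bar>Re z\<bar> = 1 - \<eta> \<or> 2 * \<bar>Im z\<bar> = d"
    proof (rule ccontr)
      assume *: "\<not> ?thesis"
      define V where "V = {z. \<bar>Re z\<bar> < 1 - \<eta> \<and> 2 * \<bar>Im z\<bar> < 1 - \<bar>Re z\<bar>}"
      have "open V" unfolding V_def
        by (intro open_Collect_conj open_Collect_less continuous_intros)
      moreover have "V \<subseteq> U" by (auto simp: U_def V_def)
      moreover have "z \<in> V" using * z(1) by (auto simp: U_def V_def d_def)
      ultimately show False using z(2) interior_maximal by blast
    qed
    then have "cmod (f z) \<le> exp (4 * L / d\<^sup>2)"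
    proof
      assume "\<bar>Re z\<bar> = 1 - \<eta>"
      then have deq: "d = \<eta>" by (simp add: d_def)
      have "cmod (f z) \<le> N" using N smallU z by blast
      also have "N = exp (ln N)" using N by simp
      also have "\<dots> \<le> exp (4 * L / d\<^sup>2)"
      proof -
        have "ln N \<le> 1 / d\<^sup>2" using \<eta>2 deq by simp
        also have "\<dots> \<le> 4 * L / d\<^sup>2" using L \<open>d\<^sup>2 > 0\<close> by (simp add: divide_right_mono)
        finally show ?thesis by simp
      qed
      finally show ?thesis .
    next
      assume eq: "2 * \<bar>Im z\<bar> = d"
      then have "d\<^sup>2 = 4 * (Im z)\<^sup>2" by (simp flip: eq add: power_mult_distrib)
      then have "L / (Im z)\<^sup>2 = 4 * L / d\<^sup>2" by simp
      then show ?thesis using bound[of z] eq d \<eta> by (auto simp: d_def)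
    qed
    then have "cmod (\<phi> z) \<le> exp (4 * L / d\<^sup>2) * exp (- (9 * L * Re (E z)))"
      unfolding norm\<phi> by (intro mult_right_mono) auto
    also have "\<dots> \<le> 1" using E9 by (simp flip: exp_add)
    finally show "cmod (\<phi> z) \<le> 1" .
  qed (use boundedU in auto)
  then have "cmod (f w) \<le> exp (9 * L * Re (E w))"
    by (simp add: norm\<phi> exp_minus field_simps)
  \<comment> \<open>Here 1 - w and 1 + w have real part 1, hence modulus at least 1; undoing the
    barrier costs at most 9 * 2 * L.\<close>
  also have "Re (E w) \<le> 2"
  proof -
    have "cmod u \<ge> 1" if "Re u = 1" for u using that complex_Re_le_cmod[of u] by simp
    then have "1 \<le> (cmod u)\<^sup>2" if "Re u = 1" for u
      using that one_le_power by blast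
    then have *: "cmod (1 / u\<^sup>2) \<le> 1" if "Re u = 1" for u
      using frac_le[of 1 1 1 "(cmod u)\<^sup>2"] that by (simp add: norm_divide norm_power)
    have "Re (E w) \<le> cmod (1 / (1 - w)\<^sup>2) + cmod (1 / (1 + w)\<^sup>2)"
      unfolding E_def plus_complex.sel using complex_Re_le_cmod add_mono by blast
    also have "\<dots> \<le> 1 + 1" using w by (intro add_mono *) auto
    finally show ?thesis by simp
  qed
  then have "exp (9 * L * Re (E w)) \<le> exp (18 * L)" using L by simp
  finally show ?thesis .
qed

text \<open>For large z outside the strip |Im z| <= 1 the lower bound on g can be divided out. In
  the strip the disc estimate gives exp (4 * l / (Im z)^2) with l logarithmic in Re z, and the
  rhombus turns this into exp (72 * l), a power of |z|. The degree bound involves only p, the decay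
  exponent of g, so it is the same for all S over a given g.\<close>

lemma quotient_polynomial_growth:
  assumes S: "S holomorphic_on UNIV" and g: "g holomorphic_on {z. Im z \<noteq> 0}"
    and M: "M > 0"
    and gM: "\<And>z. Im z \<noteq> 0 \<Longrightarrow> cmod (g z) \<le> M / \<bar>Im z\<bar>"
    and SgM: "\<And>z. Im z \<noteq> 0 \<Longrightarrow> cmod (S z * g z) \<le> M / \<bar>Im z\<bar>"
    and \<kappa>: "\<kappa> > 0" and X: "X \<ge> 2"
    and lower: "\<And>z. \<bar>Im z\<bar> \<ge> 1 \<Longrightarrow> cmod z \<ge> X \<Longrightarrow> \<kappa> / cmod z ^ p \<le> cmod (g z)"
  shows "\<exists>P. degree P \<le> 72 * p \<and> (\<forall>z. S z = poly P z)"
proof -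
  \<comment> \<open>\<open>Q (Re c)\<close> bounds 4 * M / |g c| at the disc centres c below, where
    |Im c| = 1. The 4 is the 2 of \<open>quotient_bound_disc\<close> times the 2 from the height y /
    2 of the circle; the maximum with 1 keeps ln Q nonnegative.\<close>
  define Q where "Q = (\<lambda>x::real. max 1 (4 * M / \<kappa>) * (\<bar>x\<bar> + 2) ^ p)"
  have Q1: "Q x \<ge> 1" for x unfolding Q_def
    using mult_mono[of 1 "max 1 (4 * M / \<kappa>)" 1 "(\<bar>x\<bar> + 2) ^ p"] by (simp add: one_le_power)
  have Qmono: "Q x \<le> Q y" if "\<bar>x\<bar> \<le> \<bar>y\<bar>" for x y
    unfolding Q_def using that by (intro mult_left_mono power_mono) auto
  have near: "cmod (S w) \<le> exp (4 * (ln (Q (Re w)) + 1) / (Im w)\<^sup>2)"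
    if w: "\<bar>Re w\<bar> \<ge> X" "Im w \<noteq> 0" "\<bar>Im w\<bar> \<le> 1" for w
  proof -
    define y where "y = \<bar>Im w\<bar>"
    have y: "0 < y" "y \<le> 1" using w by (auto simp: y_def)
    define c where "c = Complex (Re w) (sgn (Im w))"
    \<comment> \<open>Halfway between the distance 1 - y from \<open>c\<close> to \<open>w\<close>
      and the distance 1 from \<open>c\<close> to the real line: the circle keeps distance y / 2
      from both \<open>w\<close> and the line.\<close>
    define r where "r = 1 - y / 2"
    have Imc: "\<bar>Im c\<bar> = 1" using w by (simp add: c_def abs_sgn_eq)
    have dcw: "dist c w = 1 - y"
    proof -
      have "c - w = Complex 0 (sgn (Im w) * (1 - y))"
        by (simp add: c_def complex_eq_iff y_def algebra_simps) (simp add: abs_sgn mult.commute)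
      then have "cmod (c - w) = \<bar>sgn (Im w) * (1 - y)\<bar>"
        by (simp add: complex_norm)
      then show ?thesis using y w by (simp add: dist_norm abs_mult abs_sgn_eq)
    qed
    have Im_ge: "\<bar>Im z\<bar> \<ge> 1 - dist c z" for z
    proof -
      have "\<bar>Im c - Im z\<bar> \<le> dist c z" using abs_Im_le_cmod[of "c - z"] by (simp add: dist_norm)
      then show ?thesis using Imc by linarith
    qed
    have sub: "ball c 1 \<subseteq> {z. Im z \<noteq> 0}" 
    proof
      fix z assume "z \<in> ball c 1"
      then show "z \<in> {z. Im z \<noteq> 0}" using Im_ge[of z] by auto
    qed
    have cX: "cmod c \<ge> X" using w(1) abs_Re_le_cmod[of c] by (simp add: c_def)
    have gc: "\<kappa> / cmod c ^ p \<le> cmod (g c)" using lower[of c] Imc cX by simp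
    have c0: "cmod c > 0" using cX X by linarith
    then have "\<kappa> / cmod c ^ p > 0" using \<kappa> by simp
    then have gc0: "g c \<noteq> 0" using gc by auto
    have circ: "M / \<bar>Im z\<bar> \<le> 2 * M / y" "Im z \<noteq> 0" if "dist c z = r" for z
    proof -
      have le: "y / 2 \<le> \<bar>Im z\<bar>" using Im_ge[of z] that by (simp add: r_def)
      then show "Im z \<noteq> 0" using y by auto
      have "M / \<bar>Im z\<bar> \<le> M / (y / 2)" using le M y by (intro divide_left_mono) auto
      then show "M / \<bar>Im z\<bar> \<le> 2 * M / y" by (simp add: mult.commute)
    qed
    have "cmod (S w) \<le> (2 * (2 * M / y) / cmod (g c)) powr ((r + dist c w) / (r - dist c w))"
    proof (rule quotient_bound_disc[of _ _ 1])
      show "S holomorphic_on ball c 1" using S holomorphic_on_subset by blast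
      show "g holomorphic_on ball c 1" using g sub holomorphic_on_subset by blast
      show "cmod (g z) \<le> 2 * M / y" if "dist c z = r" for z
        using gM[of z] circ[OF that] by linarith
      show "cmod (S z * g z) \<le> 2 * M / y" if "dist c z = r" for z
        using SgM[of z] circ[OF that] by linarith
    qed (use y M gc0 dcw in \<open>auto simp: r_def\<close>)
    also have "\<dots> \<le> (Q (Re w) / y) powr ((r + dist c w) / (r - dist c w))"
    proof (rule powr_mono2)
      have "cmod c \<le> \<bar>Re w\<bar> + 2" using cmod_le[of c] Imc by (simp add: c_def)
      then have "cmod c ^ p \<le> (\<bar>Re w\<bar> + 2) ^ p" by (intro power_mono) auto
      have "4 * M / cmod (g c) \<le> 4 * M / (\<kappa> / cmod c ^ p)"
        using gc M \<open>\<kappa> / cmod c ^ p > 0\<close> by (intro frac_le) auto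
      also have "\<dots> = 4 * M / \<kappa> * cmod c ^ p" by simp
      also have "\<dots> \<le> Q (Re w)" unfolding Q_def
        using \<open>cmod c ^ p \<le> (\<bar>Re w\<bar> + 2) ^ p\<close> M \<kappa> by (intro mult_mono) auto
      finally have "4 * M / cmod (g c) / y \<le> Q (Re w) / y" using y by (intro divide_right_mono) auto
      then show "2 * (2 * M / y) / cmod (g c) \<le> Q (Re w) / y" by (simp add: field_simps)
    qed (use y M dcw in \<open>auto simp: r_def\<close>)
    also have "\<dots> \<le> (Q (Re w) / y) powr (4 / y)"
    proof (rule powr_mono)
      show "1 \<le> Q (Re w) / y" using Q1[of "Re w"] y by (simp add: field_simps) 
      have "(r + dist c w) / (r - dist c w) = (2 - 3 / 2 * y) / (y / 2)"
        by (simp add: r_def dcw)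
      also have "\<dots> \<le> 2 / (y / 2)" using y by (intro divide_right_mono) auto
      finally show "(r + dist c w) / (r - dist c w) \<le> 4 / y" by simp
    qed
    also have "\<dots> = exp (4 / y * (ln (Q (Re w)) - ln y))"
      using Q1[of "Re w"] y by (simp add: powr_def ln_div)
    also have "\<dots> \<le> exp (4 * (ln (Q (Re w)) + 1) / y\<^sup>2)"
    proof -
      \<comment> \<open>A second factor 1 / y pays for the logarithm of y and brings the bound into
        the form that \<open>rhombus_bound\<close> expects.\<close>
      have "ln (1 / y) \<le> 1 / y - 1" using y by (intro ln_le_minus_one) auto
      then have "- ln y \<le> 1 / y" using y by (simp add: ln_div)
      then have 1: "- ln y * y \<le> 1" using y by (simp add: field_simps)
      have "ln (Q (Re w)) * y \<le> ln (Q (Re w)) * 1"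
        using y Q1[of "Re w"] by (intro mult_left_mono) auto
      then have "(ln (Q (Re w)) - ln y) * y \<le> ln (Q (Re w)) + 1" using 1 by (simp add: algebra_simps)
      then have "(ln (Q (Re w)) - ln y) \<le> (ln (Q (Re w)) + 1) / y" using y by (simp add: field_simps)
      then have "4 / y * (ln (Q (Re w)) - ln y) \<le> 4 / y * ((ln (Q (Re w)) + 1) / y)"
        using y by (intro mult_left_mono) auto
      then show ?thesis by (simp add: power2_eq_square)
    qed
    also have "y\<^sup>2 = (Im w)\<^sup>2" by (simp add: y_def)
    finally show ?thesis .
  qed
  have strip: "cmod (S z) \<le> exp (72 * (ln (Q (\<bar>Re z\<bar> + 1)) + 1))"
    if z: "\<bar>Re z\<bar> \<ge> X + 1" "\<bar>Im z\<bar> \<le> 1" for z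
  proof -
    \<comment> \<open>Evaluated at |Re z| + 1 so that one constant serves all of |Re w - Re z| <= 1,
      which contains the translated rhombus.\<close>
    define l where "l = ln (Q (\<bar>Re z\<bar> + 1)) + 1"
    have l1: "l \<ge> 1" using Q1 by (simp add: l_def)
    have near': "cmod (S w) \<le> exp (4 * l / (Im w)\<^sup>2)"
      if "\<bar>Re w - Re z\<bar> \<le> 1" "Im w \<noteq> 0" "\<bar>Im w\<bar> \<le> 1" for w
    proof -
      have "cmod (S w) \<le> exp (4 * (ln (Q (Re w)) + 1) / (Im w)\<^sup>2)"
        using that z by (intro near) auto
      also have "\<dots> \<le> exp (4 * l / (Im w)\<^sup>2)"
        unfolding exp_le_cancel_iff l_def
        using Qmono[of "Re w" "\<bar>Re z\<bar> + 1"] that Q1[of "Re w"]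
        by (intro divide_right_mono mult_left_mono add_right_mono ln_mono) auto
      finally show ?thesis .
    qed
    show ?thesis
    proof (cases "\<bar>Im z\<bar> \<le> 1 / 4")
      case True
      define f where "f = (\<lambda>u. S (of_real (Re z) + u))"
      have "cmod (f (Complex 0 (Im z))) \<le> exp (18 * (4 * l))"
      proof (rule rhombus_bound[where f = f and w = "Complex 0 (Im z)"])
        have "(S \<circ> (\<lambda>u. of_real (Re z) + u)) holomorphic_on UNIV"
          by (rule holomorphic_on_compose_gen[OF _ S]) (auto intro!: holomorphic_intros)
        then show "f holomorphic_on UNIV" by (simp add: f_def o_def)
        show "cmod (f u) \<le> exp (4 * l / (Im u)\<^sup>2)"
          if "\<bar>Re u\<bar> \<le> 1" "Im u \<noteq> 0" "\<bar>Im u\<bar> \<le> 1" for u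
          using near'[of "of_real (Re z) + u"] that by (simp add: f_def)
      qed (use l1 True in auto)
      moreover have "of_real (Re z) + Complex 0 (Im z) = z" by (simp add: complex_eq_iff)
      ultimately show ?thesis by (simp add: f_def l_def)
    next
      case False
      then have "(1 / 4)\<^sup>2 \<le> \<bar>Im z\<bar>\<^sup>2" by (intro power_mono) auto
      then have "4 * l / (Im z)\<^sup>2 \<le> 4 * l / (1 / 4)\<^sup>2"
        using l1 False by (intro divide_left_mono) (auto simp: power2_eq_square)
      \<comment> \<open>At heights above 1/4 the singular bound itself suffices, because 4 * 16 =
        64.\<close>
      also have "\<dots> \<le> 72 * l" using l1 by (simp add: power2_eq_square)
      finally have "exp (4 * l / (Im z)\<^sup>2) \<le> exp (72 * l)" by simp
      moreover have "cmod (S z) \<le> exp (4 * l / (Im z)\<^sup>2)" using False z by (intro near') auto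
      ultimately show ?thesis unfolding l_def by (rule order_trans[rotated])
    qed
  qed
  define K where "K = max (M / \<kappa>) ((exp 1 * max 1 (4 * M / \<kappa>) * 3 ^ p) ^ 72)"
  have growth: "cmod (S z) \<le> K * cmod z ^ (72 * p)" if z: "X + 2 \<le> cmod z" for z
  proof (cases "\<bar>Im z\<bar> \<le> 1")
    case True
    have "\<bar>Re z\<bar> \<ge> X + 1" using cmod_le[of z] z True by linarith
    then have "cmod (S z) \<le> exp (72 * (ln (Q (\<bar>Re z\<bar> + 1)) + 1))" using strip True by blast
    also have "\<dots> = (exp 1 * Q (\<bar>Re z\<bar> + 1)) ^ 72"
    proof -
      have "exp 1 * Q (\<bar>Re z\<bar> + 1) = exp (ln (Q (\<bar>Re z\<bar> + 1)) + 1)"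
        using Q1[of "\<bar>Re z\<bar> + 1"] by (simp add: exp_add)
      then show ?thesis by (simp only: exp_of_nat_mult[symmetric] of_nat_numeral)
    qed
    also have "\<dots> \<le> (exp 1 * max 1 (4 * M / \<kappa>) * 3 ^ p * cmod z ^ p) ^ 72"
    proof (rule power_mono)
      have "\<bar>\<bar>Re z\<bar> + 1\<bar> + 2 \<le> 3 * cmod z" using abs_Re_le_cmod[of z] z X by linarith
      then have "(\<bar>\<bar>Re z\<bar> + 1\<bar> + 2) ^ p \<le> (3 * cmod z) ^ p" by (intro power_mono) auto
      then have "Q (\<bar>Re z\<bar> + 1) \<le> max 1 (4 * M / \<kappa>) * (3 * cmod z) ^ p"
        unfolding Q_def by (intro mult_left_mono) auto
      then show "exp 1 * Q (\<bar>Re z\<bar> + 1) \<le> exp 1 * max 1 (4 * M / \<kappa>) * 3 ^ p * cmod z ^ p"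
        by (simp add: power_mult_distrib mult.assoc)
      show "0 \<le> exp 1 * Q (\<bar>Re z\<bar> + 1)" using Q1[of "\<bar>Re z\<bar> + 1"] by simp
    qed
    also have "\<dots> = (exp 1 * max 1 (4 * M / \<kappa>) * 3 ^ p) ^ 72 * cmod z ^ (72 * p)"
      by (simp only: power_mult_distrib[of _ "cmod z ^ p"] power_mult[symmetric] mult.commute[of 72 p])
    also have "\<dots> \<le> K * cmod z ^ (72 * p)" by (intro mult_right_mono) (auto simp: K_def)
    finally show ?thesis .
  next
    case False
    have z1: "cmod z \<ge> 1" using z X by linarith
    then have "z \<noteq> 0" by auto
    have pos: "\<kappa> / cmod z ^ p > 0" using \<kappa> z1 by (intro divide_pos_pos zero_less_power) linarith+
    have gz: "\<kappa> / cmod z ^ p \<le> cmod (g z)" using lower[of z] False z by simp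
    have "cmod (S z) * (\<kappa> / cmod z ^ p) \<le> cmod (S z * g z)"
      unfolding norm_mult using gz by (intro mult_left_mono) auto
    also have "\<dots> \<le> M / \<bar>Im z\<bar>" using SgM[of z] False by force
    also have "\<dots> \<le> M / 1" using M False by (intro divide_left_mono) auto
    finally have "cmod (S z) \<le> M / \<kappa> * cmod z ^ p"
      using \<kappa> \<open>z \<noteq> 0\<close> by (simp add: field_simps)
    also have "\<dots> \<le> K * cmod z ^ (72 * p)"
    proof (intro mult_mono power_increasing)
      show "M / \<kappa> \<le> K" by (simp add: K_def)
      have "0 \<le> M / \<kappa>" using M \<kappa> by simp
      then show "0 \<le> K" using \<open>M / \<kappa> \<le> K\<close> by linarith
    qed (use z1 in auto)
    finally show ?thesis .
  qed
  define P where "P = (\<Sum>k\<le>72 * p. monom ((deriv ^^ k) S 0 / fact k) k)"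
  have "S z = poly P z" for z
    unfolding P_def using Liouville_polynomial[OF S growth] by (simp add: poly_sum poly_monom)
  moreover have "degree P \<le> 72 * p"
    unfolding P_def by (intro degree_sum_le) (auto intro: order_trans[OF degree_monom_le])
  ultimately show ?thesis by blast
qed

section \<open>Cauchy series\<close>

lemma zero_quotient_holomorphic:
  assumes "f holomorphic_on UNIV" "f w = 0"
  shows "zero_quotient f w holomorphic_on UNIV"
proof -
  have "zero_quotient f w = (\<lambda>z. if z = w then deriv f w else (f z - f w) / (z - w))"
    using assms(2) by (auto simp: zero_quotient_def)
  then show ?thesis using pole_lemma[of f UNIV w] assms(1) by simp
qed

lemma zero_quotient_mult: "f w = 0 \<Longrightarrow> (z - w) * zero_quotient f w z = f z"
  by (simp add: zero_quotient_def)

text \<open>At a simple zero z of g both functions can be divided by u - z. The new denominator does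
  not vanish at z, so the local quotient is holomorphic, with the quotient of the derivatives as its
  value at z.\<close>

lemma entire_quotient:
  assumes f: "f holomorphic_on UNIV" and g: "g holomorphic_on UNIV"
    and zero: "\<And>z. g z = 0 \<Longrightarrow> f z = 0 \<and> deriv g z \<noteq> 0"
  shows "\<exists>q. q holomorphic_on UNIV \<and> (\<forall>z. q z * g z = f z)"
proof -
  define q where "q = (\<lambda>z. if g z = 0 then deriv f z / deriv g z else f z / g z)"
  have "\<exists>U. open U \<and> z \<in> U \<and> q holomorphic_on U" for z
  proof (cases "g z = 0")
    case False
    have "open (g -` (- {0}))"
      using g holomorphic_on_imp_continuous_on open_vimage[of "- {0}" g] by auto
    moreover have "(\<lambda>z. f z / g z) holomorphic_on (g -` (- {0}))"
      by (intro holomorphic_intros holomorphic_on_subset[OF f] holomorphic_on_subset[OF g]) auto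
    then have "q holomorphic_on (g -` (- {0}))"
      by (rule holomorphic_transform) (auto simp: q_def)
    ultimately show ?thesis using False by blast
  next
    case True
    define f1 where "f1 = zero_quotient f z"
    define g1 where "g1 = zero_quotient g z"
    have f1: "f1 holomorphic_on UNIV" and g1: "g1 holomorphic_on UNIV"
      using zero_quotient_holomorphic f g zero True by (auto simp: f1_def g1_def)
    have "open (g1 -` (- {0}))"
      using g1 holomorphic_on_imp_continuous_on open_vimage[of "- {0}" g1] by auto
    moreover have "(\<lambda>z. f1 z / g1 z) holomorphic_on (g1 -` (- {0}))"
      by (intro holomorphic_intros holomorphic_on_subset[OF f1] holomorphic_on_subset[OF g1]) auto
    then have "q holomorphic_on (g1 -` (- {0}))"
    proof (rule holomorphic_transform)
      fix u assume "u \<in> g1 -` (- {0})"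
      then show "f1 u / g1 u = q u"
        using True zero[of z] by (auto simp: q_def f1_def g1_def zero_quotient_def)
    qed
    moreover have "g1 z \<noteq> 0" using True zero by (simp add: g1_def zero_quotient_def)
    ultimately show ?thesis by blast
  qed
  then obtain U where U: "\<And>z. open (U z)" "\<And>z. z \<in> U z" "\<And>z. q holomorphic_on U z" by metis
  have "q holomorphic_on (\<Union>z\<in>UNIV. U z)" using U by (intro holomorphic_on_UN_open) auto
  moreover have "(\<Union>z\<in>UNIV. U z) = UNIV" using U(2) by auto
  moreover have "q z * g z = f z" for z using zero[of z] by (simp add: q_def)
  ultimately show ?thesis by metis
qed

text \<open>This is F times a Cauchy series, with F taken inside so that each pole at a node cancels
  in its own term. Near a given point all but finitely many nodes are at distance at least 1, so the
  tail is dominated by |\<sigma> n| times a local bound of |F|.\<close>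

lemma cauchy_series_entire:
  fixes t :: "nat \<Rightarrow> complex"
  assumes F: "F holomorphic_on UNIV" "\<And>n. F (t n) = 0"
    and t: "\<And>r. finite {n. cmod (t n) \<le> r}"
    and \<sigma>: "summable (\<lambda>n. cmod (\<sigma> n))"
  shows "summable (\<lambda>n. \<sigma> n * zero_quotient F (t n) z)"
    and "(\<lambda>z. \<Sum>n. \<sigma> n * zero_quotient F (t n) z) holomorphic_on UNIV"
proof -
  define f where "f = (\<lambda>n z. \<sigma> n * zero_quotient F (t n) z)"
  have bound: "\<exists>K. \<forall>\<^sub>F n in sequentially. \<forall>z\<in>cball x 1. norm (f n z) \<le> cmod (\<sigma> n) * K" for x
  proof -
    have "compact (F ` cball x 1)"
      by (intro compact_continuous_image continuous_on_subset[OF holomorphic_on_imp_continuous_on[OF F(1)]]) auto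
    then have "bounded (F ` cball x 1)" by (rule compact_imp_bounded)
    then obtain K where "\<forall>y\<in>F ` cball x 1. norm y \<le> K" unfolding bounded_iff ..
    then have K: "cmod (F z) \<le> K" if "z \<in> cball x 1" for z using that by (rule bspec[OF _ imageI])
    have "\<forall>\<^sub>F n in sequentially. n \<notin> {n. cmod (t n) \<le> cmod x + 2}"
      using t[of "cmod x + 2"]
      by (simp only: cofinite_eq_sequentially[symmetric] eventually_cofinite not_not Collect_mem_eq)
    then have "\<forall>\<^sub>F n in sequentially. \<forall>z\<in>cball x 1. norm (f n z) \<le> cmod (\<sigma> n) * K"
    proof eventually_elim
      case (elim n)
      show ?case
      proof
        fix z assume z: "z \<in> cball x 1"
        have "cmod z \<le> cmod x + 1"
          using z norm_triangle_ineq2[of z x] by (simp add: dist_norm norm_minus_commute)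
        then have d: "cmod (z - t n) \<ge> 1"
          using elim norm_triangle_ineq2[of "t n" z] by (simp add: norm_minus_commute)
        then have "zero_quotient F (t n) z = F z / (z - t n)" by (auto simp: zero_quotient_def)
        moreover have "cmod (F z) / cmod (z - t n) \<le> K / 1"
          using K[OF z] d by (intro frac_le) (auto intro: order_trans[OF norm_ge_zero])
        ultimately show "norm (f n z) \<le> cmod (\<sigma> n) * K"
          using mult_left_mono[of "cmod (F z) / cmod (z - t n)" K "cmod (\<sigma> n)"]
          by (simp add: f_def norm_mult norm_divide)
      qed
    qed
    then show ?thesis by blast
  qed
  show "summable (\<lambda>n. \<sigma> n * zero_quotient F (t n) z)"
  proof -
    obtain K where K: "\<forall>\<^sub>F n in sequentially. \<forall>u\<in>cball z 1. norm (f n u) \<le> cmod (\<sigma> n) * K"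
      using bound by blast
    have "\<forall>\<^sub>F n in sequentially. norm (f n z) \<le> cmod (\<sigma> n) * K"
      by (rule eventually_mono[OF K]) simp
    then have "summable (\<lambda>n. f n z)"
      using summable_mult2[OF \<sigma>] by (rule summable_comparison_test_ev)
    then show ?thesis by (simp add: f_def)
  qed
  have "(\<lambda>z. \<Sum>n. f n z) holomorphic_on UNIV"
  proof (rule holomorphic_uniform_sequence)
    show "(\<lambda>z. \<Sum>i<n. f i z) holomorphic_on UNIV" for n
      unfolding f_def by (intro holomorphic_intros zero_quotient_holomorphic F)
    fix x :: complex
    obtain K where K: "\<forall>\<^sub>F n in sequentially. \<forall>z\<in>cball x 1. norm (f n z) \<le> cmod (\<sigma> n) * K"
      using bound by blast
    have "uniform_limit (cball x 1) (\<lambda>n z. \<Sum>i<n. f i z) (\<lambda>z. \<Sum>n. f n z) sequentially"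
      by (rule Weierstrass_m_test_ev[OF K]) (rule summable_mult2[OF \<sigma>])
    then show "\<exists>d>0. cball x d \<subseteq> UNIV \<and>
        uniform_limit (cball x d) (\<lambda>n z. \<Sum>i<n. f i z) (\<lambda>z. \<Sum>n. f n z) sequentially"
      by (intro exI[of _ 1]) auto
  qed simp
  then show "(\<lambda>z. \<Sum>n. \<sigma> n * zero_quotient F (t n) z) holomorphic_on UNIV" by (simp add: f_def)
qed

lemma cauchy_sum_bound:
  fixes t :: "nat \<Rightarrow> complex"
  assumes t: "\<And>n. Im (t n) = 0" and \<sigma>: "summable (\<lambda>n. cmod (\<sigma> n))" and z: "Im z \<noteq> 0"
  shows "summable (\<lambda>n. \<sigma> n / (z - t n))"
    and "cmod (\<Sum>n. \<sigma> n / (z - t n)) \<le> (\<Sum>n. cmod (\<sigma> n)) / \<bar>Im z\<bar>"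
proof -
  have le: "cmod (\<sigma> n / (z - t n)) \<le> cmod (\<sigma> n) * (1 / \<bar>Im z\<bar>)" for n
  proof -
    have "\<bar>Im z\<bar> \<le> cmod (z - t n)" using abs_Im_le_cmod[of "z - t n"] t by simp
    then have "cmod (\<sigma> n) / cmod (z - t n) \<le> cmod (\<sigma> n) / \<bar>Im z\<bar>"
      using z by (intro frac_le) auto
    then show ?thesis by (simp add: norm_divide)
  qed
  have sum: "summable (\<lambda>n. cmod (\<sigma> n / (z - t n)))"
    by (rule summable_comparison_test'[OF summable_mult2[OF \<sigma>, of "1 / \<bar>Im z\<bar>"]]) (use le in auto)
  then show "summable (\<lambda>n. \<sigma> n / (z - t n))" by (rule summable_norm_cancel)
  have "cmod (\<Sum>n. \<sigma> n / (z - t n)) \<le> (\<Sum>n. cmod (\<sigma> n / (z - t n)))" by (rule summable_norm[OF sum])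
  also have "\<dots> \<le> (\<Sum>n. cmod (\<sigma> n) * (1 / \<bar>Im z\<bar>))"
    by (rule suminf_le[OF le sum summable_mult2[OF \<sigma>]])
  also have "\<dots> = (\<Sum>n. cmod (\<sigma> n)) / \<bar>Im z\<bar>" using suminf_mult2[OF \<sigma>, of "1 / \<bar>Im z\<bar>"] by simp
  finally show "cmod (\<Sum>n. \<sigma> n / (z - t n)) \<le> (\<Sum>n. cmod (\<sigma> n)) / \<bar>Im z\<bar>" .
qed

text \<open>The first nonvanishing moment governs the decay, via
  \<open>z \<cdot> t\<^sup>j / (z - t) = t\<^sup>j + t\<^bsup>j + 1\<^esup> / (z - t)\<close>.\<close>

lemma cauchy_sum_lower_bound:
  fixes t :: "nat \<Rightarrow> complex"
  assumes t: "\<And>n. Im (t n) = 0" and \<beta>: "\<And>j. summable (\<lambda>n. cmod (\<beta> n * t n ^ j))"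
    and k: "(\<Sum>n. \<beta> n * t n ^ k) \<noteq> 0" "\<And>j. j < k \<Longrightarrow> (\<Sum>n. \<beta> n * t n ^ j) = 0"
  shows "\<exists>\<kappa>>0. \<exists>X\<ge>2. \<forall>z. \<bar>Im z\<bar> \<ge> 1 \<longrightarrow> cmod z \<ge> X \<longrightarrow>
    \<kappa> / cmod z ^ Suc k \<le> cmod (\<Sum>n. \<beta> n / (z - t n))"
proof -
  define m where "m = (\<lambda>j. \<Sum>n. \<beta> n * t n ^ j)"
  define G where "G = (\<lambda>j z. \<Sum>n. \<beta> n * t n ^ j / (z - t n))"
  \<comment> \<open>The recursion is used beyond index k: for |Im z| >= 1 it bounds
    \<open>z * G (Suc k) z\<close> by \<open>K\<close>. Then \<open>X\<close> is chosen so that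
    \<open>G (Suc k) z\<close> takes away at most half of \<open>m k\<close>.\<close>
  define K where "K = cmod (m (Suc k)) + (\<Sum>n. cmod (\<beta> n * t n ^ Suc (Suc k)))"
  define X where "X = max 2 (2 * K / cmod (m k))"
  have rec: "z * G j z = m j + G (Suc j) z" if "Im z \<noteq> 0" for z j
  proof -
    have ne: "z - t n \<noteq> 0" for n using that t[of n] by auto
    have "z * G j z = (\<Sum>n. z * (\<beta> n * t n ^ j / (z - t n)))"
      unfolding G_def by (rule suminf_mult[symmetric]) (rule cauchy_sum_bound(1)[OF t \<beta> that])
    also have "\<dots> = (\<Sum>n. \<beta> n * t n ^ j + \<beta> n * t n ^ Suc j / (z - t n))"
      using ne by (intro suminf_cong) (simp add: field_simps)
    also have "\<dots> = m j + G (Suc j) z"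
      unfolding m_def G_def
      by (intro suminf_add[symmetric] cauchy_sum_bound(1)[OF t \<beta> that] summable_norm_cancel[OF \<beta>])
    finally show ?thesis .
  qed
  have low: "z ^ j * G 0 z = G j z" if "j \<le> k" "Im z \<noteq> 0" for z j
    using that
  proof (induction j)
    case (Suc j)
    then have "z ^ Suc j * G 0 z = z * G j z" by (simp add: mult.assoc)
    then show ?case using rec[of z j] k(2)[of j] Suc by (simp add: m_def)
  qed simp
  have K0: "K \<ge> 0" unfolding K_def by (intro add_nonneg_nonneg suminf_nonneg \<beta>) auto
  have mk: "cmod (m k) > 0" using k by (simp add: m_def)
  have "cmod (m k) / 2 / cmod z ^ Suc k \<le> cmod (G 0 z)" if z: "\<bar>Im z\<bar> \<ge> 1" "cmod z \<ge> X" for z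
  proof -
    have Imz: "Im z \<noteq> 0" using z by auto
    have z0: "cmod z > 0" using z X_def by auto
    have "cmod (G (Suc (Suc k)) z) \<le> (\<Sum>n. cmod (\<beta> n * t n ^ Suc (Suc k))) / \<bar>Im z\<bar>"
      unfolding G_def by (rule cauchy_sum_bound(2)[OF t \<beta> Imz])
    also have "\<dots> \<le> (\<Sum>n. cmod (\<beta> n * t n ^ Suc (Suc k))) / 1"
      using z by (intro frac_le suminf_nonneg \<beta>) auto
    finally have "cmod (z * G (Suc k) z) \<le> K"
      unfolding rec[OF Imz] K_def using norm_triangle_ineq[of "m (Suc k)" "G (Suc (Suc k)) z"] by simp
    then have "cmod (G (Suc k) z) \<le> K / cmod z"
      using z0 by (simp add: norm_mult field_simps)
    also have "\<dots> \<le> cmod (m k) / 2"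
    proof -
      have "2 * K / cmod (m k) \<le> cmod z" using z(2) by (simp add: X_def)
      then show ?thesis using z0 mk by (simp add: field_simps)
    qed
    finally have "cmod (m k) / 2 \<le> cmod (m k + G (Suc k) z)"
      using norm_diff_ineq[of "m k" "G (Suc k) z"] by simp
    also have "m k + G (Suc k) z = z ^ Suc k * G 0 z"
      using rec[OF Imz, of k] low[OF order_refl Imz] by (simp add: mult.assoc)
    finally show ?thesis using z0 by (simp add: norm_mult norm_power field_simps)
  qed
  moreover have "G 0 = (\<lambda>z. \<Sum>n. \<beta> n / (z - t n))" by (simp add: G_def)
  ultimately show ?thesis using mk by (intro exI[of _ "cmod (m k) / 2"] conjI exI[of _ X]) (auto simp: X_def)
qed

text \<open>Functionals that separate \<open>N\<close> embed it into a space of dimension card J.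
  The induction passes to the kernel of one functional, of codimension at most 1, and restores the
  loss by one vector \<open>b\<close> on which that functional is nonzero.\<close>

lemma (in entire_hilbert_space) finite_span_by_functionals:
  assumes "finite J" "cfun.subspace N" "N \<subseteq> H" "\<And>n. n \<in> J \<Longrightarrow> \<psi> n \<in> H"
    and "\<And>h. h \<in> N \<Longrightarrow> (\<And>n. n \<in> J \<Longrightarrow> ip h (\<psi> n) = 0) \<Longrightarrow> h = 0"
  shows "\<exists>B. finite B \<and> B \<subseteq> N \<and> N \<subseteq> cfun.span B"
  using assms
proof (induction J arbitrary: N)
  case empty
  then have "N \<subseteq> {0}" by blast
  then show ?case by (intro exI[of _ "{}"]) auto
next
  case (insert j J)
  define N0 where "N0 = {h \<in> N. ip h (\<psi> j) = 0}"
  have \<psi>j: "\<psi> j \<in> H" using insert.prems by blast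
  have N0: "cfun.subspace N0"
  proof (rule cfun.subspaceI)
    show "0 \<in> N0"
      using cfun.subspace_0[OF insert.prems(1)] ip_zero_left[OF \<psi>j] by (simp add: N0_def)
    show "x + y \<in> N0" if "x \<in> N0" "y \<in> N0" for x y
      using that cfun.subspace_add[OF insert.prems(1)] insert.prems(2) \<psi>j
      by (simp add: N0_def subset_eq ip_add_left)
    show "cscale c x \<in> N0" if "x \<in> N0" for c x
      using that cfun.subspace_scale[OF insert.prems(1)] insert.prems(2) \<psi>j
      by (simp add: N0_def subset_eq ip_scale_left)
  qed
  have "\<exists>B. finite B \<and> B \<subseteq> N0 \<and> N0 \<subseteq> cfun.span B"
  proof (rule insert.IH[OF N0])
    show "N0 \<subseteq> H" using insert.prems(2) by (auto simp: N0_def)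
    show "\<psi> n \<in> H" if "n \<in> J" for n using that insert.prems(3) by simp
    show "h = 0" if "h \<in> N0" "\<And>n. n \<in> J \<Longrightarrow> ip h (\<psi> n) = 0" for h
    proof (rule insert.prems(4))
      show "h \<in> N" using that(1) by (simp add: N0_def)
      show "ip h (\<psi> n) = 0" if "n \<in> insert j J" for n
        using that \<open>h \<in> N0\<close> \<open>\<And>n. n \<in> J \<Longrightarrow> ip h (\<psi> n) = 0\<close> by (cases "n = j") (auto simp: N0_def)
    qed
  qed
  then obtain B where B: "finite B" "B \<subseteq> N0" "N0 \<subseteq> cfun.span B" by metis
  show ?case
  proof (cases "N0 = N")
    case True
    then show ?thesis using B by blast
  next
    case False
    then obtain b where b: "b \<in> N" "ip b (\<psi> j) \<noteq> 0" by (auto simp: N0_def)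
    have "N \<subseteq> cfun.span (insert b B)"
    proof
      fix h assume h: "h \<in> N"
      define a where "a = ip h (\<psi> j) / ip b (\<psi> j)"
      have hb: "h \<in> H" "b \<in> H" using h b insert.prems by auto
      have "h - cscale a b \<in> N"
        using h b insert.prems(1) cfun.subspace_diff cfun.subspace_scale by blast
      moreover have "ip (h - cscale a b) (\<psi> j) = 0"
        using hb \<psi>j b by (simp add: ip_diff_left hs_scale ip_scale_left a_def)
      ultimately have "h - cscale a b \<in> cfun.span B" using B(3) by (auto simp: N0_def)
      then show "h \<in> cfun.span (insert b B)" using cfun.span_breakdown_eq by blast
    qed
    then show ?thesis using B b by (intro exI[of _ "insert b B"]) (auto simp: N0_def)
  qed
qed

section \<open>Spaces of the class with a generating function\<close>

locale generated_class_R = class_R H ip t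
  for H :: "(complex \<Rightarrow> complex) set"
    and ip :: "(complex \<Rightarrow> complex) \<Rightarrow> (complex \<Rightarrow> complex) \<Rightarrow> complex"
    and t :: "nat \<Rightarrow> complex" +
  fixes F :: "complex \<Rightarrow> complex"
  assumes generating: "generating_function H ip t F"
begin

definition \<nu> :: "nat \<Rightarrow> real" where "\<nu> n = hnorm ip (rkernel H ip (t n))"

definition \<psi> :: "nat \<Rightarrow> complex \<Rightarrow> complex" where
  "\<psi> n = cscale (complex_of_real (\<nu> n) / deriv F (t n)) (zero_quotient F (t n))"

lemma F_entire: "F holomorphic_on UNIV"
  and F_t: "F (t n) = 0"
  and deriv_F_t: "deriv F (t n) \<noteq> 0"
  and biorthogonal_\<psi>: "biorthogonal_system H ip UNIV (\<lambda>n. normalized_rkernel H ip (t n)) \<psi>"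
  using generating by (auto simp: generating_function_def \<psi>_def[abs_def] \<nu>_def)

lemma \<psi>_in: "\<psi> n \<in> H"
  using biorthogonal_\<psi> by (auto simp: biorthogonal_system_def)

lemma rkernel: "is_reproducing_kernel H ip z (rkernel H ip z)"
  unfolding rkernel_def
proof (rule theI'[of "is_reproducing_kernel H ip z"])
  obtain k where k: "is_reproducing_kernel H ip z k" using A1 by blast
  have "k' = k" if "is_reproducing_kernel H ip z k'" for k'
  proof -
    have H: "k \<in> H" "k' \<in> H" using k that by (auto simp: is_reproducing_kernel_def)
    then have d: "k' - k \<in> H" by (simp add: hs_diff)
    then have "ip (k' - k) k' = ip (k' - k) k"
      using k that unfolding is_reproducing_kernel_def by simp
    then have "ip (k' - k) (k' - k) = 0" using ip_diff_right[OF H(2,1) d] by simp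
    then show ?thesis using ip_definite[OF d] by simp
  qed
  then show "\<exists>!k. is_reproducing_kernel H ip z k" using k by blast
qed

lemma rkernel_in: "rkernel H ip z \<in> H"
  using rkernel by (simp add: is_reproducing_kernel_def)

lemma ip_rkernel_right: "f \<in> H \<Longrightarrow> ip f (rkernel H ip z) = f z"
  using rkernel by (simp add: is_reproducing_kernel_def)

lemma ip_rkernel_left: "f \<in> H \<Longrightarrow> ip (rkernel H ip z) f = cnj (f z)"
  using ip_commute[OF _ rkernel_in] ip_rkernel_right by simp

lemma \<nu>_pos: "\<nu> n > 0"
proof (rule ccontr)
  assume "\<not> ?thesis"
  then have "\<nu> n = 0" using hnorm_ge0[OF rkernel_in] by (simp add: \<nu>_def order_less_le)
  then have "normalized_rkernel H ip (t n) = 0"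
    by (simp add: normalized_rkernel_def \<nu>_def cscale_def zero_fun_def)
  then have "ip (normalized_rkernel H ip (t n)) (\<psi> n) = 0" by (simp add: ip_zero_left \<psi>_in)
  then show False using biorthogonal_\<psi> by (simp add: biorthogonal_system_def)
qed

lemma ip_normalized_rkernel:
  "f \<in> H \<Longrightarrow> ip f (normalized_rkernel H ip (t n)) = f (t n) / complex_of_real (\<nu> n)"
  by (simp add: normalized_rkernel_def ip_scale_right rkernel_in ip_rkernel_right \<nu>_def)

lemma summable_values: "f \<in> H \<Longrightarrow> summable (\<lambda>n. (cmod (f (t n)) / \<nu> n)\<^sup>2)"
  using riesz_basis_expansion(1)[OF A3 biorthogonal_\<psi>, of f f] \<nu>_pos
  by (simp add: ip_normalized_rkernel norm_divide abs_of_pos)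

lemma summable_coefficients: "h \<in> H \<Longrightarrow> summable (\<lambda>n. (cmod (ip h (\<psi> n)))\<^sup>2)"
  using riesz_basis_expansion(2)[OF A3 biorthogonal_\<psi>, of h h] .

lemma ip_sums:
  "\<lbrakk>f \<in> H; h \<in> H\<rbrakk> \<Longrightarrow> (\<lambda>n. f (t n) / complex_of_real (\<nu> n) * cnj (ip h (\<psi> n))) sums ip f h"
  using riesz_basis_expansion(3)[OF A3 biorthogonal_\<psi>, of f h] by (simp add: ip_normalized_rkernel)

text \<open>Lagrange interpolation at the nodes: \<open>ip_sums\<close> with the kernel at z as
  second argument, whose conjugated coefficients are the values \<open>\<psi> n z\<close>.\<close>

lemma interpolation:
  assumes "f \<in> H"
  shows "(\<lambda>n. f (t n) / deriv F (t n) * zero_quotient F (t n) z) sums f z"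
proof -
  have "f (t n) / complex_of_real (\<nu> n) * cnj (ip (rkernel H ip z) (\<psi> n)) =
      f (t n) / deriv F (t n) * zero_quotient F (t n) z" for n
    using \<nu>_pos[of n] by (simp add: ip_rkernel_left \<psi>_in) (simp add: \<psi>_def cscale_def)
  then show ?thesis
    using ip_sums[OF assms rkernel_in[of z]] ip_rkernel_right[OF assms] by simp
qed

lemma eq_0_if_values_0:
  assumes "f \<in> H" "\<And>n. f (t n) = 0"
  shows "f = 0"
proof
  fix z
  have "(\<lambda>n. 0) sums f z" using interpolation[OF assms(1), of z] assms(2) by simp
  then show "f z = 0 z" using sums_unique2[OF _ sums_zero] by simp
qed

lemma eq_0_if_coefficients_0:
  assumes h: "h \<in> H" "\<And>n. ip h (\<psi> n) = 0"
  shows "h = 0"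
proof -
  have "(\<lambda>n. 0) sums ip h h" using ip_sums[OF h(1) h(1)] h(2) by simp
  then have "ip h h = 0" using sums_unique2 sums_zero by blast
  then show ?thesis using ip_definite h(1) by blast
qed

text \<open>The nodes are distinct zeros of F, and F is not constant because its derivative is
  nonzero at a node.\<close>

lemma finite_nodes: "finite {n. cmod (t n) \<le> r}"
proof -
  have "\<not> F constant_on UNIV"
  proof
    assume "F constant_on UNIV"
    then obtain c where "F = (\<lambda>_. c)" by (auto simp: constant_on_def)
    then show False using deriv_F_t[of 0] by simp
  qed
  then have "finite {z \<in> cball 0 r. F z = 0}"
    by (intro holomorphic_compact_finite_zeros[OF F_entire]) auto
  then have "finite (t -` {z \<in> cball 0 r. F z = 0})" using distinct by (rule finite_vimageI)
  then show ?thesis by (rule rev_finite_subset) (auto simp: F_t)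
qed

lemma zero_quotient_F_off: "z \<noteq> t n \<Longrightarrow> zero_quotient F (t n) z = F z / (z - t n)"
  by (simp add: zero_quotient_def)

lemma zero_quotient_F_at: "zero_quotient F (t n) (t m) = (if n = m then deriv F (t n) else 0)"
  using distinct by (simp add: zero_quotient_def F_t inj_eq)

lemma cauchy_series_at_node: "(\<Sum>n. \<sigma> n * zero_quotient F (t n) (t m)) = \<sigma> m * deriv F (t m)"
proof -
  have "(\<lambda>n. \<sigma> n * zero_quotient F (t n) (t m)) = (\<lambda>n. if n = m then \<sigma> n * deriv F (t n) else 0)"
    by (auto simp: zero_quotient_F_at)
  then show ?thesis using sums_single[of m "\<lambda>n. \<sigma> n * deriv F (t n)"] by (simp add: sums_iff)
qed

end

locale exact_kernel_system = generated_class_R H ip t F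
  for H :: "(complex \<Rightarrow> complex) set"
    and ip :: "(complex \<Rightarrow> complex) \<Rightarrow> (complex \<Rightarrow> complex) \<Rightarrow> complex"
    and t :: "nat \<Rightarrow> complex" and F :: "complex \<Rightarrow> complex" +
  fixes \<Lambda> :: "complex set" and w :: "complex \<Rightarrow> complex \<Rightarrow> complex" and l0 :: complex
  assumes complete_kernels: "complete_system H ip \<Lambda> (rkernel H ip)"
    and biorthogonal: "biorthogonal_system H ip \<Lambda> (rkernel H ip) w"
    and l0: "l0 \<in> \<Lambda>"
begin

definition W :: "complex \<Rightarrow> complex" where "W = w l0"

lemma w_in: "\<mu> \<in> \<Lambda> \<Longrightarrow> w \<mu> \<in> H"
  using biorthogonal by (auto simp: biorthogonal_system_def)

lemma w_value: "\<lbrakk>\<mu> \<in> \<Lambda>; l \<in> \<Lambda>\<rbrakk> \<Longrightarrow> w \<mu> l = (if l = \<mu> then 1 else 0)"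
proof -
  assume *: "\<mu> \<in> \<Lambda>" "l \<in> \<Lambda>"
  then have "cnj (w \<mu> l) = (if l = \<mu> then 1 else 0)"
    using biorthogonal ip_rkernel_left[OF w_in] by (auto simp: biorthogonal_system_def)
  then show ?thesis by (metis complex_cnj_cnj complex_cnj_one complex_cnj_zero)
qed

lemma W_in: "W \<in> H" and W_l0: "W l0 = 1" and W_\<Lambda>: "l \<in> \<Lambda> \<Longrightarrow> l \<noteq> l0 \<Longrightarrow> W l = 0"
  using w_in[OF l0] w_value[OF l0] l0 by (auto simp: W_def)

lemma eq_0_on_\<Lambda>: "f \<in> H \<Longrightarrow> (\<And>l. l \<in> \<Lambda> \<Longrightarrow> f l = 0) \<Longrightarrow> f = 0"
  using complete_system_orthogonal_eq_0[OF complete_kernels, of f] ip_rkernel_left by simp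

text \<open>Moving the zero of \<open>W\<close> from \<open>z0\<close> to \<open>l0\<close> produces an element of \<open>H\<close> that vanishes on
  \<open>\<Lambda> - {z0}\<close>, hence a multiple of \<open>w z0\<close>.\<close>

lemma W_zero:
  assumes z0: "W z0 = 0"
  shows "z0 \<in> \<Lambda>" "deriv W z0 \<noteq> 0" "zero_quotient W z0 \<in> cfun.span (w ` \<Lambda>)"
proof -
  define W1 where "W1 = zero_quotient W z0"
  have W1: "W1 \<in> H" using A2[OF W_in z0] by (simp add: W1_def)
  have z0l: "z0 \<noteq> l0" using z0 W_l0 by auto
  \<comment> \<open>This is W * (z - l0) / (z - z0), written as a sum so that membership in
    \<open>H\<close> follows from \<open>A2\<close>.\<close>
  define q where "q = W + cscale (z0 - l0) W1"
  have q: "q \<in> H" unfolding q_def by (intro hs_add hs_scale W_in W1)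
  have q_off: "q z = W z * (z - l0) / (z - z0)" if "z \<noteq> z0" for z
  proof -
    have eq: "q z = W z + (z0 - l0) * W1 z" by (simp add: q_def cscale_def)
    have "(z - z0) * q z = (z - z0) * W z + (z0 - l0) * ((z - z0) * W1 z)"
      unfolding eq by (simp add: algebra_simps)
    also have "(z - z0) * W1 z = W z" using z0 by (simp add: W1_def zero_quotient_mult)
    finally have "(z - z0) * q z = W z * (z - l0)" by (simp add: algebra_simps)
    then show ?thesis using that by (simp add: field_simps)
  qed
  have q_at: "q z0 = (z0 - l0) * deriv W z0"
    by (simp add: q_def cscale_def W1_def zero_quotient_def z0)
  have q\<Lambda>: "q l = 0" if "l \<in> \<Lambda>" "l \<noteq> z0" for l
    using that W_\<Lambda>[of l] by (auto simp: q_off)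
  \<comment> \<open>Otherwise \<open>W\<close> would vanish on a punctured neighbourhood of
    \<open>l0\<close>, against continuity and \<open>W l0 = 1\<close>.\<close>
  have "q \<noteq> 0"
  proof
    assume "q = 0"
    then have zero: "W z = 0" if "z \<noteq> z0" "z \<noteq> l0" for z
      using q_off[of z] that by (simp add: zero_fun_def)
    have "isCont W l0"
      using entire[OF W_in] holomorphic_on_imp_continuous_on continuous_on_eq_continuous_at by blast
    then have "(W \<longlongrightarrow> 1) (at l0)" using W_l0 by (simp add: isCont_def)
    moreover have "eventually (\<lambda>z. W z = 0) (at l0)"
    proof -
      have "eventually (\<lambda>z. z \<in> - {z0}) (nhds l0)" using z0l by (intro eventually_nhds_in_open) auto
      then have "eventually (\<lambda>z. z \<noteq> z0) (at l0)" by (simp add: eventually_at_filter eventually_mono)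
      moreover have "eventually (\<lambda>z. z \<noteq> l0) (at l0)" by (simp add: eventually_at_filter)
      ultimately show ?thesis by eventually_elim (rule zero)
    qed
    then have "(W \<longlongrightarrow> 0) (at l0)" by (rule tendsto_eventually)
    ultimately show False using tendsto_unique[of "at l0" W 1 0] by simp
  qed
  \<comment> \<open>By completeness \<open>q\<close> is nonzero somewhere on \<Lambda>, and
    \<open>z0\<close> is the only candidate. The value there is z0 - l0 times the derivative of
    \<open>W\<close>, so the zero is simple.\<close>
  then have "\<exists>l\<in>\<Lambda>. q l \<noteq> 0" using eq_0_on_\<Lambda>[OF q] by blast
  then have *: "z0 \<in> \<Lambda>" "q z0 \<noteq> 0" using q\<Lambda> by auto
  then show "z0 \<in> \<Lambda>" "deriv W z0 \<noteq> 0" by (auto simp: q_at)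
  have "q - cscale (q z0) (w z0) = 0"
  proof (rule eq_0_on_\<Lambda>)
    show "q - cscale (q z0) (w z0) \<in> H" by (intro hs_diff hs_scale q w_in *)
    show "(q - cscale (q z0) (w z0)) l = 0" if "l \<in> \<Lambda>" for l
      using q\<Lambda>[of l] w_value[OF *(1) that] that by (cases "l = z0") (auto simp: cscale_def)
  qed
  then have qw: "q = cscale (q z0) (w z0)" by simp
  have "W1 = cscale (1 / (z0 - l0)) (q - W)"
    using z0l by (auto simp: q_def cscale_def fun_eq_iff)
  also have "\<dots> \<in> cfun.span (w ` \<Lambda>)"
    by (subst qw, unfold W_def)
      (intro cfun.span_scale cfun.span_diff cfun.span_base imageI l0 *)
  finally show "zero_quotient W z0 \<in> cfun.span (w ` \<Lambda>)" by (simp add: W1_def)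
qed

text \<open>This permits dividing by F off the real line. By interpolation, a zero of F outside the
  nodes is a common zero of all of \<open>H\<close>, in particular of \<open>W\<close>, hence a
  point of \<Lambda>; but \<open>w z\<close> has the value 1 there.\<close>

lemma F_nonzero:
  assumes "\<And>n. z \<noteq> t n"
  shows "F z \<noteq> 0"
proof
  assume "F z = 0"
  then have "zero_quotient F (t n) z = 0" for n using assms by (simp add: zero_quotient_F_off)
  then have "(\<lambda>n. 0) sums f z" if "f \<in> H" for f
    using interpolation[OF that, of z] by simp
  then have "f z = 0" if "f \<in> H" for f
    using that sums_unique2[OF _ sums_zero] by blast
  then have "W z = 0" "z \<in> \<Lambda> \<Longrightarrow> w z z = 0" using W_in w_in by auto
  then show False using W_zero(1)[of z] w_value[of z z] by auto
qed

end

section \<open>The orthogonal complement of the biorthogonal system\<close>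

context exact_kernel_system
begin

text \<open>The residue of W / F at the node \<open>t n\<close>.\<close>

definition \<beta> :: "nat \<Rightarrow> complex" where "\<beta> n = W (t n) / deriv F (t n)"

definition b :: "nat \<Rightarrow> real" where "b = weight H ip t F"

lemma b_eq: "b n = (\<nu> n / cmod (deriv F (t n)))\<^sup>2"
  by (simp add: b_def weight_def \<nu>_def power_divide)

lemma b_pos: "b n > 0"
  using \<nu>_pos[of n] deriv_F_t[of n] by (simp add: b_eq)

lemma norm_\<beta>: "cmod (\<beta> n) = cmod (W (t n)) / \<nu> n * sqrt (b n)"
  using \<nu>_pos[of n] by (simp add: \<beta>_def b_eq norm_divide real_sqrt_abs abs_of_pos)

lemma \<beta>_sums: "(\<lambda>n. \<beta> n * zero_quotient F (t n) z) sums W z"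
  using interpolation[OF W_in, of z] by (simp add: \<beta>_def)

lemma polynomial_summable:
  assumes "polynomials_on (range t) \<subseteq> weighted_l2 t b"
  shows "summable (\<lambda>n. (cmod (poly p (t n)))\<^sup>2 * b n)"
proof -
  have "restrict (poly p) (range t) \<in> weighted_l2 t b"
    using assms by (auto simp: polynomials_on_def)
  then show ?thesis by (simp add: weighted_l2_def)
qed

text \<open>Each term is a product of |W (t n)| / \<nu> n and |p (t n)| * sqrt (b n), two square
  summable sequences. Consequently all moments of \<beta> converge absolutely.\<close>

lemma \<beta>_polynomial_summable:
  assumes "polynomials_on (range t) \<subseteq> weighted_l2 t b"
  shows "summable (\<lambda>n. cmod (\<beta> n * poly p (t n)))"
proof (rule summable_comparison_test')
  show "summable (\<lambda>n. (cmod (W (t n)) / \<nu> n)\<^sup>2 + (cmod (poly p (t n)))\<^sup>2 * b n)"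
    by (intro summable_add summable_values W_in polynomial_summable assms)
  show "norm (cmod (\<beta> n * poly p (t n))) \<le> (cmod (W (t n)) / \<nu> n)\<^sup>2 + (cmod (poly p (t n)))\<^sup>2 * b n" for n
  proof -
    define x where "x = cmod (W (t n)) / \<nu> n"
    define y where "y = cmod (poly p (t n)) * sqrt (b n)"
    have xy: "x \<ge> 0" "y \<ge> 0" using \<nu>_pos[of n] b_pos[of n] by (auto simp: x_def y_def)
    have "cmod (\<beta> n * poly p (t n)) = x * y" by (simp add: norm_mult norm_\<beta> x_def y_def)
    also have "\<dots> \<le> 2 * x * y" using xy by simp
    also have "\<dots> \<le> x\<^sup>2 + y\<^sup>2" by (rule sum_squares_bound)
    also have "y\<^sup>2 = (cmod (poly p (t n)))\<^sup>2 * b n" using b_pos[of n] by (simp add: y_def power_mult_distrib)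
    finally show ?thesis by (simp add: x_def)
  qed
qed

text \<open>On polynomials p, the sum of \<beta> n * p (t n) is an inner product with a fixed
  element of the weighted space. If it is always zero, density forces that element to vanish, so
  \<open>W\<close> is zero at all nodes and therefore everywhere, against
  \<open>W l0 = 1\<close>.\<close>

lemma moments_not_all_zero:
  assumes poly: "polynomials_on (range t) \<subseteq> weighted_l2 t b" and dense: "polynomials_dense t b"
  shows "\<exists>k. (\<Sum>n. \<beta> n * t n ^ k) \<noteq> 0"
proof (rule ccontr)
  assume "\<not> ?thesis"
  then have moments: "(\<Sum>n. \<beta> n * t n ^ k) = 0" for k by blast
  have monom_summable: "summable (\<lambda>n. \<beta> n * t n ^ k)" for k
    using summable_norm_cancel[OF \<beta>_polynomial_summable[OF poly, of "monom 1 k"]]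
    by (simp add: poly_monom)
  have \<beta>p: "(\<lambda>n. \<beta> n * poly p (t n)) sums 0" for p
  proof -
    have "(\<lambda>n. \<Sum>k\<le>degree p. coeff p k * (\<beta> n * t n ^ k)) sums (\<Sum>k\<le>degree p. coeff p k * 0)"
      using moments monom_summable by (intro sums_sum sums_mult) (simp add: sums_iff)
    then show ?thesis by (simp add: poly_altdef sum_distrib_left algebra_simps)
  qed
  \<comment> \<open>The element representing the functional; the conjugate makes
    \<open>\<beta> n * u (t n)\<close> the nonnegative number \<open>V n\<close> defined next. Off
    the nodes the value is \<open>undefined\<close>, as \<open>extensional\<close> demands.\<close>
  define u where "u = (\<lambda>z. if z \<in> range t then cnj (\<beta> (inv t z)) / b (inv t z) else undefined)"
  have u_t: "u (t n) = cnj (\<beta> n) / b n" for n using distinct by (simp add: u_def)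
  define V where "V = (\<lambda>n. (cmod (W (t n)) / \<nu> n)\<^sup>2)"
  have V: "summable V" unfolding V_def by (rule summable_values[OF W_in])
  have Vu: "(cmod (u (t n)))\<^sup>2 * b n = V n" and V\<beta>: "\<beta> n * u (t n) = of_real (V n)" for n
  proof -
    have "(cmod (\<beta> n))\<^sup>2 = V n * b n"
      unfolding norm_\<beta> V_def power_mult_distrib using b_pos[of n] by simp
    then show "(cmod (u (t n)))\<^sup>2 * b n = V n"
      using b_pos[of n] by (simp add: u_t norm_divide power_divide power2_eq_square)
    have "\<beta> n * cnj (\<beta> n) = complex_of_real (V n * b n)"
      using \<open>(cmod (\<beta> n))\<^sup>2 = V n * b n\<close> complex_norm_square[of "\<beta> n"] by (metis)
    then show "\<beta> n * u (t n) = of_real (V n)"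
      using b_pos[of n] by (simp add: u_t)
  qed
  have u: "u \<in> weighted_l2 t b"
    using V Vu by (simp add: weighted_l2_def u_def[unfolded fun_eq_iff] extensional_def)
  have small: "suminf V \<le> \<epsilon>\<^sup>2" if pos: "\<epsilon> > 0" for \<epsilon> :: real
  proof -
    obtain p where p: "weighted_l2_norm t b (\<lambda>z. u z - restrict (poly p) (range t) z) < \<epsilon>"
      using dense[unfolded polynomials_dense_def polynomials_on_def, rule_format, OF u pos]
      by (elim bexE imageE) simp
    define D where "D = (\<lambda>n. (cmod (u (t n) - poly p (t n)))\<^sup>2 * b n)"
    \<comment> \<open>\<open>weighted_l2_norm\<close> is built on an infinite sum, so its being
      small carries information only once that sum is known to converge.\<close>
    have D: "summable D"
    proof (rule summable_comparison_test')
      show "summable (\<lambda>n. 2 * V n + 2 * ((cmod (poly p (t n)))\<^sup>2 * b n))"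
        by (intro summable_add summable_mult V polynomial_summable poly)
      fix n
      have "(cmod (u (t n) - poly p (t n)))\<^sup>2 \<le> (cmod (u (t n)) + cmod (poly p (t n)))\<^sup>2"
        by (intro power_mono norm_triangle_ineq4) auto
      also have "\<dots> \<le> 2 * (cmod (u (t n)))\<^sup>2 + 2 * (cmod (poly p (t n)))\<^sup>2"
        using sum_squares_bound[of "cmod (u (t n))" "cmod (poly p (t n))"] by (simp add: power2_sum)
      finally have "D n \<le> (2 * (cmod (u (t n)))\<^sup>2 + 2 * (cmod (poly p (t n)))\<^sup>2) * b n"
        unfolding D_def using b_pos[of n] by (intro mult_right_mono) auto
      also have "\<dots> = 2 * V n + 2 * ((cmod (poly p (t n)))\<^sup>2 * b n)"
        unfolding Vu[symmetric] by (simp add: algebra_simps)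
      finally show "norm (D n) \<le> 2 * V n + 2 * ((cmod (poly p (t n)))\<^sup>2 * b n)"
        using b_pos[of n] by (simp add: D_def)
    qed
    have D0: "suminf D \<ge> 0" using b_pos by (intro suminf_nonneg D) (simp add: D_def less_imp_le)
    have "sqrt (suminf D) < \<epsilon>" using p by (simp add: weighted_l2_norm_def D_def)
    then have D\<epsilon>: "suminf D \<le> \<epsilon>\<^sup>2"
      using D0 that by (metis less_imp_le real_sqrt_le_iff real_sqrt_unique)
    have "(\<lambda>n. \<beta> n * u (t n) - \<beta> n * poly p (t n)) sums (of_real (suminf V) - 0)"
      unfolding V\<beta> by (intro sums_diff \<beta>p sums_of_real summable_sums V)
    then have s: "(\<lambda>n. \<beta> n * (u (t n) - poly p (t n))) sums of_real (suminf V)"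
      by (simp add: algebra_simps)
    \<comment> \<open>This termwise bound stands in for the Cauchy-Schwarz inequality: after
      summation it reads sum V <= (sum V + sum D) / 2, hence sum V <= sum D.\<close>
    have le: "norm (\<beta> n * (u (t n) - poly p (t n))) \<le> (V n + D n) / 2" for n
    proof -
      define y where "y = cmod (u (t n) - poly p (t n)) * sqrt (b n)"
      have "norm (\<beta> n * (u (t n) - poly p (t n))) = cmod (W (t n)) / \<nu> n * y"
        by (simp add: norm_mult norm_\<beta> y_def)
      also have "\<dots> \<le> (V n + y\<^sup>2) / 2"
      proof -
        have "x * y \<le> (x\<^sup>2 + y\<^sup>2) / 2" for x :: real
          using sum_squares_bound[of x y] by (simp add: mult.assoc)
        then show ?thesis by (simp only: V_def)
      qed
      also have "y\<^sup>2 = D n" using b_pos[of n] by (simp add: y_def D_def power_mult_distrib)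
      finally show ?thesis .
    qed
    have VD: "summable (\<lambda>n. (V n + D n) / 2)" by (intro summable_divide summable_add V D)
    have "norm (complex_of_real (suminf V)) \<le> (\<Sum>n. (V n + D n) / 2)"
      unfolding sums_unique[OF s] by (rule norm_suminf_le[OF le VD])
    also have "\<dots> = (suminf V + suminf D) / 2"
      using suminf_divide[OF summable_add[OF V D], of 2] suminf_add[OF V D] by simp
    finally show ?thesis using D\<epsilon> by simp
  qed
  have "suminf V \<le> 0 + \<epsilon>" if "\<epsilon> > 0" for \<epsilon> :: real
    using small[of "sqrt \<epsilon>"] that by simp
  then have "suminf V \<le> 0" by (rule field_le_epsilon)
  moreover have V_nonneg: "0 \<le> V n" for n by (simp add: V_def)
  ultimately have "suminf V = 0" using suminf_nonneg[OF V V_nonneg] by linarith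
  then have V0: "V n = 0" for n by (simp only: suminf_eq_zero_iff[OF V V_nonneg])
  have "W (t n) = 0" for n using V0[of n] \<nu>_pos[of n] by (simp add: V_def)
  then have "W = 0" using eq_0_if_values_0[OF W_in] by blast
  then show False using W_l0 by simp
qed

lemma W_quotient_lower_bound:
  assumes poly: "polynomials_on (range t) \<subseteq> weighted_l2 t b" and dense: "polynomials_dense t b"
    and real: "range t \<subseteq> \<real>"
  shows "\<exists>k. \<exists>\<kappa>>0. \<exists>X\<ge>2. \<forall>z. \<bar>Im z\<bar> \<ge> 1 \<longrightarrow> cmod z \<ge> X \<longrightarrow>
    \<kappa> / cmod z ^ Suc k \<le> cmod (\<Sum>n. \<beta> n / (z - t n))"
proof -
  define k where "k = (LEAST k. (\<Sum>n. \<beta> n * t n ^ k) \<noteq> 0)"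
  have k: "(\<Sum>n. \<beta> n * t n ^ k) \<noteq> 0"
    unfolding k_def using moments_not_all_zero[OF poly dense] by (rule LeastI_ex)
  have lt: "(\<Sum>n. \<beta> n * t n ^ j) = 0" if "j < k" for j
    using not_less_Least[of j "\<lambda>k. (\<Sum>n. \<beta> n * t n ^ k) \<noteq> 0"] that unfolding k_def by blast
  have Im: "Im (t n) = 0" for n
    using real complex_is_Real_iff by blast
  have sum: "summable (\<lambda>n. cmod (\<beta> n * t n ^ j))" for j
    using \<beta>_polynomial_summable[OF poly, of "monom 1 j"] by (simp add: poly_monom)
  show ?thesis using cauchy_sum_lower_bound[OF Im sum k lt] by blast
qed

text \<open>Finitely many Riesz coefficients separate the orthogonal complement. \<open>J\<close> is
  fixed before h, which is possible because the degree bound for S comes from \<open>W\<close>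
  alone.\<close>

lemma finite_orthogonal_complement:
  assumes poly: "polynomials_on (range t) \<subseteq> weighted_l2 t b" and dense: "polynomials_dense t b"
    and real: "range t \<subseteq> \<real>"
  shows "\<exists>J. finite J \<and> (\<forall>h\<in>H. (\<forall>x\<in>cfun.span (w ` \<Lambda>). ip x h = 0) \<longrightarrow>
    (\<forall>n\<in>J. ip h (\<psi> n) = 0) \<longrightarrow> h = 0)"
proof -
  obtain k \<kappa> X where \<kappa>: "\<kappa> > 0" "X \<ge> 2"
    and lower: "\<And>z. \<bar>Im z\<bar> \<ge> 1 \<Longrightarrow> cmod z \<ge> X \<Longrightarrow> \<kappa> / cmod z ^ Suc k \<le> cmod (\<Sum>n. \<beta> n / (z - t n))"
    using W_quotient_lower_bound[OF assms] by metis
  define J0 where "J0 = {n. W (t n) \<noteq> 0}"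
  \<comment> \<open>One node more than the degree bound, chosen where \<open>W\<close> is nonzero so
    that S can be read off there. If only finitely many nodes qualify, all of them are
    taken.\<close>
  obtain J where J: "finite J" "J \<subseteq> J0" "J = J0 \<or> card J = Suc (72 * Suc k)"
    using infinite_arbitrarily_large[of J0 "Suc (72 * Suc k)"] by (cases "finite J0") auto
  have Im: "Im (t n) = 0" for n
    using real complex_is_Real_iff by blast
  have off: "z \<noteq> t n" if "Im z \<noteq> 0" for z n using that Im by auto
  have \<beta>1: "summable (\<lambda>n. cmod (\<beta> n))"
    using \<beta>_polynomial_summable[OF poly, of 1] by simp
  define g where "g = (\<lambda>z. \<Sum>n. \<beta> n / (z - t n))"
  have cauchy_off: "(\<Sum>n. \<sigma> n * zero_quotient F (t n) z) = F z * (\<Sum>n. \<sigma> n / (z - t n))"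
    if "Im z \<noteq> 0" "summable (\<lambda>n. cmod (\<sigma> n))" for \<sigma> z
    using suminf_mult[OF cauchy_sum_bound(1)[OF Im that(2,1)], of "F z"]
    by (simp add: zero_quotient_F_off off[OF that(1)] mult.commute)
  have Wg: "W z = F z * g z" if "Im z \<noteq> 0" for z
    using cauchy_off[OF that \<beta>1] sums_unique[OF \<beta>_sums[of z]] by (simp add: g_def)
  have F_off: "F z \<noteq> 0" if "Im z \<noteq> 0" for z using F_nonzero off[OF that] by blast
  have "(\<lambda>z. W z / F z) holomorphic_on {z. Im z \<noteq> 0}"
    by (intro holomorphic_intros holomorphic_on_subset[OF entire[OF W_in]] holomorphic_on_subset[OF F_entire])
      (use F_off in auto)
  then have g_hol: "g holomorphic_on {z. Im z \<noteq> 0}"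
    by (rule holomorphic_transform) (use Wg F_off in auto)
  have orthogonal_eq_0: "h = 0" if h: "h \<in> H" "\<And>x. x \<in> cfun.span (w ` \<Lambda>) \<Longrightarrow> ip x h = 0"
    "\<And>n. n \<in> J \<Longrightarrow> ip h (\<psi> n) = 0" for h
  proof -
    define c where "c = (\<lambda>n. cnj (ip h (\<psi> n)))"
    define \<sigma> where "\<sigma> = (\<lambda>n. W (t n) / complex_of_real (\<nu> n) * c n)"
    have ip_h: "(\<lambda>n. f (t n) / complex_of_real (\<nu> n) * c n) sums ip f h" if "f \<in> H" for f
      using ip_sums[OF that h(1)] by (simp add: c_def)
    have \<sigma>1: "summable (\<lambda>n. cmod (\<sigma> n))"
    proof (rule summable_comparison_test')
      show "summable (\<lambda>n. (cmod (W (t n)) / \<nu> n)\<^sup>2 + (cmod (ip h (\<psi> n)))\<^sup>2)"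
        by (intro summable_add summable_values summable_coefficients W_in h)
      show "norm (cmod (\<sigma> n)) \<le> (cmod (W (t n)) / \<nu> n)\<^sup>2 + (cmod (ip h (\<psi> n)))\<^sup>2" for n
      proof -
        define x where "x = cmod (W (t n)) / \<nu> n"
        define y where "y = cmod (ip h (\<psi> n))"
        have xy: "x \<ge> 0" "y \<ge> 0" using \<nu>_pos[of n] by (auto simp: x_def y_def)
        have "cmod (\<sigma> n) = x * y"
          using \<nu>_pos[of n] by (simp add: \<sigma>_def c_def norm_mult norm_divide x_def y_def)
        also have "\<dots> \<le> 2 * x * y" using xy by simp
        also have "\<dots> \<le> x\<^sup>2 + y\<^sup>2" by (rule sum_squares_bound)
        finally show ?thesis by (simp add: x_def y_def)
      qed
    qed
    define \<Phi> where "\<Phi> = (\<lambda>z. \<Sum>n. \<sigma> n * zero_quotient F (t n) z)"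
    have \<Phi>_entire: "\<Phi> holomorphic_on UNIV"
      unfolding \<Phi>_def by (rule cauchy_series_entire(2)[OF F_entire F_t finite_nodes \<sigma>1])
    have quotient_orthogonal: "(\<lambda>n. zero_quotient W z (t n) / complex_of_real (\<nu> n) * c n) sums 0"
      if "W z = 0" for z
      using ip_h[OF A2[OF W_in that]] h(2)[OF W_zero(3)[OF that]] by simp
    \<comment> \<open>At a node the only surviving term contains W (t m) = 0. Elsewhere \<Phi> z is
      - F z times the orthogonality relation for the quotient of \<open>W\<close> by its zero
      z.\<close>
    have \<Phi>_zero: "\<Phi> z = 0" if "W z = 0" for z
    proof (cases "z \<in> range t")
      case True
      then obtain m where "z = t m" by blast
      moreover from this have "\<sigma> m = 0" using that by (simp add: \<sigma>_def)
      ultimately show ?thesis by (simp add: \<Phi>_def cauchy_series_at_node)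
    next
      case False
      have "- F z * (zero_quotient W z (t n) / complex_of_real (\<nu> n) * c n) =
          \<sigma> n * zero_quotient F (t n) z" for n
      proof -
        have ne: "z \<noteq> t n" using False by blast
        then have "zero_quotient W z (t n) = - W (t n) / (z - t n)"
          by (simp add: zero_quotient_def divide_simps) (simp add: algebra_simps)
        then show ?thesis using ne by (simp add: zero_quotient_F_off \<sigma>_def ac_simps)
      qed
      then have "(\<lambda>n. \<sigma> n * zero_quotient F (t n) z) sums (- F z * 0)"
        using sums_mult[OF quotient_orthogonal[OF that], of "- F z"] by simp
      then show ?thesis by (simp add: \<Phi>_def sums_iff)
    qed
    obtain S where S: "S holomorphic_on UNIV" "\<And>z. S z * W z = \<Phi> z"
      using entire_quotient[OF \<Phi>_entire entire[OF W_in]] \<Phi>_zero W_zero(2) by metis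
    define M where "M = 1 + (\<Sum>n. cmod (\<beta> n)) + (\<Sum>n. cmod (\<sigma> n))"
    have nonneg: "0 \<le> (\<Sum>n. cmod (\<beta> n))" "0 \<le> (\<Sum>n. cmod (\<sigma> n))"
      by (intro suminf_nonneg \<beta>1 \<sigma>1; simp)+
    have "\<exists>P. degree P \<le> 72 * Suc k \<and> (\<forall>z. S z = poly P z)"
    proof (rule quotient_polynomial_growth[OF S(1) g_hol _ _ _ \<kappa>])
      show "M > 0" using nonneg by (simp add: M_def)
      show "cmod (g z) \<le> M / \<bar>Im z\<bar>" if "Im z \<noteq> 0" for z
      proof -
        have "cmod (g z) \<le> (\<Sum>n. cmod (\<beta> n)) / \<bar>Im z\<bar>"
          unfolding g_def by (rule cauchy_sum_bound(2)[OF Im \<beta>1 that])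
        also have "\<dots> \<le> M / \<bar>Im z\<bar>" using nonneg by (intro divide_right_mono) (auto simp: M_def)
        finally show ?thesis .
      qed
      show "cmod (S z * g z) \<le> M / \<bar>Im z\<bar>" if "Im z \<noteq> 0" for z
      proof -
        have "F z * (S z * g z) = \<Phi> z" using S(2)[of z] Wg[OF that] by (simp add: ac_simps)
        also have "\<dots> = F z * (\<Sum>n. \<sigma> n / (z - t n))" unfolding \<Phi>_def by (rule cauchy_off[OF that \<sigma>1])
        finally have "S z * g z = (\<Sum>n. \<sigma> n / (z - t n))" using F_off[OF that] by simp
        then have "cmod (S z * g z) \<le> (\<Sum>n. cmod (\<sigma> n)) / \<bar>Im z\<bar>"
          using cauchy_sum_bound(2)[OF Im \<sigma>1 that] by simp
        also have "\<dots> \<le> M / \<bar>Im z\<bar>" using nonneg by (intro divide_right_mono) (auto simp: M_def)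
        finally show ?thesis .
      qed
      show "\<kappa> / cmod z ^ Suc k \<le> cmod (g z)" if "1 \<le> \<bar>Im z\<bar>" "X \<le> cmod z" for z
        unfolding g_def by (rule lower[OF that])
    qed
    then obtain P where P: "degree P \<le> 72 * Suc k" "\<And>z. S z = poly P z" by blast
    have \<Phi>_node: "\<Phi> (t n) = \<sigma> n * deriv F (t n)" for n by (simp add: \<Phi>_def cauchy_series_at_node)
    have cJ: "c n = 0" if "n \<in> J" for n using h(3)[OF that] by (simp add: c_def)
    have \<sigma>0: "\<sigma> n = 0" for n
    proof (cases "J = J0")
      case True
      then show ?thesis using cJ by (cases "n \<in> J0") (auto simp: \<sigma>_def J0_def)
    next
      case False
      then have card: "card J = Suc (72 * Suc k)" using J by blast
      have "P = 0"
      proof (rule ccontr)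
        assume "P \<noteq> 0"
        \<comment> \<open>S (t n) * W (t n) equals \<open>\<sigma> n * deriv F (t n)\<close> and W
          (t n) is nonzero, so S vanishes wherever the coefficient does.\<close>
        have "S (t n) = 0" if "n \<in> J" for n
          using S(2)[of "t n"] \<Phi>_node[of n] cJ[OF that] that J(2) by (auto simp: \<sigma>_def J0_def)
        then have "t ` J \<subseteq> {z. poly P z = 0}" using P(2) by auto
        then have "card (t ` J) \<le> card {z. poly P z = 0}"
          using \<open>P \<noteq> 0\<close> poly_roots_finite by (intro card_mono) auto
        moreover have "card (t ` J) = card J" using distinct by (intro card_image) (auto intro: inj_on_subset)
        ultimately show False using card_poly_roots_bound[OF \<open>P \<noteq> 0\<close>] P(1) card by linarith
      qed
      then have "\<sigma> n * deriv F (t n) = 0" using S(2)[of "t n"] \<Phi>_node[of n] P(2) by simp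
      then show ?thesis using deriv_F_t[of n] by simp
    qed
    have "c m = 0" for m
    proof (cases "W (t m) = 0")
      case False
      then show ?thesis using \<sigma>0[of m] \<nu>_pos[of m] by (simp add: \<sigma>_def)
    next
      case True
      \<comment> \<open>Coefficients at zeros of \<open>W\<close> leave no trace in \<sigma>. The
        orthogonality relation for the quotient of \<open>W\<close> by its zero \<open>t m\<close>
        recovers them: its terms with n other than m are zero by now, and the term at m carries the
        nonzero derivative of \<open>W\<close>.\<close>
      have Wc: "W (t n) * c n = 0" for n using \<sigma>0[of n] \<nu>_pos[of n] by (auto simp: \<sigma>_def)
      have "(\<lambda>n. zero_quotient W (t m) (t n) / complex_of_real (\<nu> n) * c n) =
          (\<lambda>n. if n = m then deriv W (t n) / complex_of_real (\<nu> n) * c n else 0)"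
        using Wc distinct by (auto simp: zero_quotient_def inj_eq fun_eq_iff)
      then have "deriv W (t m) / complex_of_real (\<nu> m) * c m = 0"
        using quotient_orthogonal[OF True] sums_single[of m "\<lambda>n. deriv W (t n) / complex_of_real (\<nu> n) * c n"]
        by (metis sums_unique2)
      then show ?thesis using W_zero(2)[OF True] \<nu>_pos[of m] by simp
    qed
    then show "h = 0" using eq_0_if_coefficients_0[OF h(1)] by (simp add: c_def)
  qed
  show ?thesis
  proof (intro exI[of _ J] conjI ballI impI)
    show "finite J" by fact
    fix h assume "h \<in> H" "\<forall>x\<in>cfun.span (w ` \<Lambda>). ip x h = 0" "\<forall>n\<in>J. ip h (\<psi> n) = 0"
    then show "h = 0" by (intro orthogonal_eq_0) auto
  qed
qed

text \<open>Projection splits \<open>H\<close> into the closed span and its orthogonal complement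
  \<open>N\<close>, and \<open>N\<close> is finite-dimensional since the functionals indexed by
  \<open>J\<close> separate it.\<close>

lemma finite_codimension_closed_span:
  assumes poly: "polynomials_on (range t) \<subseteq> weighted_l2 t b" and dense: "polynomials_dense t b"
    and real: "range t \<subseteq> \<real>"
  shows "finite_codimension H (closed_span H ip (w ` \<Lambda>))"
proof -
  have w\<Lambda>: "w ` \<Lambda> \<subseteq> H" using w_in by auto
  define N where "N = {h \<in> H. \<forall>x\<in>closed_span H ip (w ` \<Lambda>). ip x h = 0}"
  have span: "x \<in> H" if "x \<in> closed_span H ip (w ` \<Lambda>)" for x
    using closed_span_subset[OF w\<Lambda>] that by blast
  have N: "cfun.subspace N"
  proof (rule cfun.subspaceI)
    show "0 \<in> N" using span by (simp add: N_def hs_zero ip_zero_right)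
    show "x + y \<in> N" if "x \<in> N" "y \<in> N" for x y
      using that span by (simp add: N_def hs_add ip_add_right)
    show "cscale a x \<in> N" if "x \<in> N" for a x
      using that span by (simp add: N_def hs_scale ip_scale_right)
  qed
  obtain J where J: "finite J" "\<And>h. \<lbrakk>h \<in> H; \<forall>x\<in>cfun.span (w ` \<Lambda>). ip x h = 0;
      \<forall>n\<in>J. ip h (\<psi> n) = 0\<rbrakk> \<Longrightarrow> h = 0"
    using finite_orthogonal_complement[OF assms] by metis
  have "\<exists>B. finite B \<and> B \<subseteq> N \<and> N \<subseteq> cfun.span B"
  proof (rule finite_span_by_functionals[OF J(1) N])
    show "N \<subseteq> H" by (auto simp: N_def)
    show "h = 0" if "h \<in> N" "\<And>n. n \<in> J \<Longrightarrow> ip h (\<psi> n) = 0" for h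
    proof (rule J(2))
      show "\<forall>x\<in>cfun.span (w ` \<Lambda>). ip x h = 0"
        using that(1) span_subset_closed_span[OF w\<Lambda>] by (auto simp: N_def)
    qed (use that in \<open>auto simp: N_def\<close>)
  qed (rule \<psi>_in)
  then obtain B where B: "finite B" "B \<subseteq> N" "N \<subseteq> cfun.span B" by blast
  show ?thesis
    unfolding finite_codimension_def
  proof (intro exI[of _ B] conjI ballI)
    show "finite B" by fact
    show "B \<subseteq> H" using B(2) by (auto simp: N_def)
    fix f assume f: "f \<in> H"
    obtain m where m: "m \<in> closed_span H ip (w ` \<Lambda>)" "\<forall>x\<in>closed_span H ip (w ` \<Lambda>). ip x (f - m) = 0"
      using closed_span_projection[OF w\<Lambda> f] by blast
    then have "f - m \<in> N" using f span hs_diff by (simp add: N_def)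
    then have "f - m \<in> cfun.span B" using B(3) by blast
    moreover have "f = m + (f - m)" by simp
    ultimately show "\<exists>m\<in>closed_span H ip (w ` \<Lambda>). \<exists>c\<in>cfun.span B. f = m + c"
      using m(1) by blast
  qed
qed

end

theorem theorem1p4:
  fixes H :: "(complex \<Rightarrow> complex) set"
    and ip :: "(complex \<Rightarrow> complex) \<Rightarrow> (complex \<Rightarrow> complex) \<Rightarrow> complex"
    and t :: "nat \<Rightarrow> complex"
    and F :: "complex \<Rightarrow> complex"
    and b :: "nat \<Rightarrow> real"
  assumes "class_R H ip t"
    and "generating_function H ip t F"
    and "b = weight H ip t F"
    and "range t \<subseteq> \<real>"
    and "polynomials_on (range t) \<subseteq> weighted_l2 t b"
    and "polynomials_dense t b"
  shows "\<forall>\<Lambda> w. exact_system H ip \<Lambda> (rkernel H ip) \<and>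
           biorthogonal_system H ip \<Lambda> (rkernel H ip) w \<longrightarrow>
           finite_codimension H (closed_span H ip (w ` \<Lambda>))"
proof (intro allI impI, elim conjE)
  fix \<Lambda> w
  assume exact: "exact_system H ip \<Lambda> (rkernel H ip)"
    and bio: "biorthogonal_system H ip \<Lambda> (rkernel H ip) w"
  have complete: "complete_system H ip \<Lambda> (rkernel H ip)"
    using exact by (simp add: exact_system_def)
  show "finite_codimension H (closed_span H ip (w ` \<Lambda>))"
  proof (cases "\<Lambda> = {}")
    \<comment> \<open>There is no \<open>l0\<close> to choose. Completeness of the empty system says
      that \<open>H\<close> is already the closed span of the empty set, which is also the image of
      \<Lambda> under \<open>w\<close>.\<close>
    case True
    then have "closed_span H ip (w ` \<Lambda>) = H" using complete by (simp add: complete_system_def)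
    moreover have "f = f + 0" for f :: "complex \<Rightarrow> complex" by simp
    ultimately show ?thesis
      unfolding finite_codimension_def using cfun.span_zero by (intro exI[of _ "{}"]) blast
  next
    case False
    then obtain l0 where l0: "l0 \<in> \<Lambda>" by blast
    interpret exact_kernel_system H ip t F \<Lambda> w l0
      using assms(1,2) complete bio l0
      by (intro exact_kernel_system.intro generated_class_R.intro generated_class_R_axioms.intro
          exact_kernel_system_axioms.intro)
    show ?thesis
      by (rule finite_codimension_closed_span) (use assms in \<open>auto simp: b_def\<close>)
  qed
qed

end
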